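(* Consider the finite-level open quantum memory system described in the context, and let $\Pi=\Pi^{\mathrm T}\succ0$ be a given matrix in $\mathbb{R}^{r\times r}$. At any time $t\geqslant0$, the problem $$\dot\Delta(t)+\frac12\|U(t)\|_\Pi^2\longrightarrow\inf$$ of minimisation over the current control value $U(t)\in\mathbb{R}^r$ (with the current matrix $z(t)$ being given) has a unique solution $$\widehat U(t)=-\Pi^{-1}g(z(t)),$$ and the corresponding value of $\dot\Delta(t)$ (for $U(t)=\widehat U(t)$) is $$\dot\Delta(t)=f(z(t))-\|g(z(t))\|_{\Pi^{-1}}^2 .$$ Here $f(v):=\langle R,A_*v+c\rangle\in\mathbb{R}$ and $g(v):=(Rv^{\mathrm T})\star\mathcal{A}\in\mathbb{R}^r$ for $v\in\mathbb{R}^{n\times(n+1)}$.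
   Context: Conventions. For an array $T=(T_{jk\ell})\in\mathbb{C}^{p\times q\times s}$ with sections $T_\ell:=(T_{jk\ell})_{j,k}\in\mathbb{C}^{p\times q}$ and a vector $w$ of $s$ entries (numbers or operators), $T\cdot w:=\sum_{\ell=1}^s T_\ell w_\ell$; also $T_{\ell\bullet\bullet}:=(T_{\ell jk})_{j,k}$. For $T\in\mathbb{R}^{n\times n\times n}$ and $u\in\mathbb{R}^n$, $T\diamond u:=\begin{bmatrix}T_1u&\ldots&T_nu\end{bmatrix}$. For a real matrix $u\in\mathbb{R}^{p\times q}$ and a real array $T\in\mathbb{R}^{p\times q\times s}$, $u\star T:=(\langle u,T_k\rangle)_{1\leqslant k\leqslant s}\in\mathbb{R}^s$, where $\langle\cdot,\cdot\rangle$ is the Frobenius inner product of real matrices. $\mathrm{vec}$ is column-stacking vectorization, $[\xi,\eta]=\xi\eta-\eta\xi$, $\|u\|_S^2:=u^{\mathrm T}Su$ for a positive definite symmetric matrix $S$, and operators and expectations act entrywise on vectors and matrices of operators. System. Let $\mathfrak{H}:=\mathfrak{H}_0\otimes\mathfrak{F}$, where $\mathfrak{H}_0$ is a finite-dimensional complex Hilbert space and $\mathfrak{F}$ is a symmetric Fock space carrying a quantum Wiener process $W=(W_k)_{1\leqslant k\leqslant m}$ ($m$ even) of self-adjoint operators with Ito table $\mathrm{d}W\mathrm{d}W^{\mathrm T}=(I_m+iJ)\mathrm{d}t$, $J:=I_{m/2}\otimes\begin{bmatrix}0&1\\-1&0\end{bmatrix}$, and $[W(s),W(t)^{\mathrm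 T}]=2i\min(s,t)J$. The state on $\mathfrak H$ is $\rho=\rho_0\otimes\upsilon$, with $\rho_0$ a density operator on $\mathfrak{H}_0$ and $\upsilon$ the vacuum state on $\mathfrak{F}$; $\mathbf{E}\zeta:=\mathrm{Tr}(\rho\zeta)$. The vector $X(t)=(X_k(t))_{1\leqslant k\leqslant n}$ of self-adjoint system variables on $\mathfrak{H}$ has initial value $X_0:=X(0)$ consisting of Hermitian operators on $\mathfrak{H}_0$ (extended to $\mathfrak H$ by tensoring with the identity) and satisfies for all $t\geqslant0$ the algebraic relations $$X(t)X(t)^{\mathrm T}=\alpha+\beta\cdot X(t),$$ where $\alpha=\alpha^{\mathrm T}\in\mathbb{R}^{n\times n}$ and $\beta\in\mathbb{C}^{n\times n\times n}$ has Hermitian sections $\beta_\ell$ (constants are identified with multiples of the identity operator). Put $\Theta:=\mathrm{Im}\,\beta=(\theta_{jk\ell})$ with sections $\Theta_\ell$, and $\gamma:=\mathrm{Re}\,\beta$ with sections $\gamma_\ell$. The control $U=(U_k)_{1\leqslant k\leqslant r}$ is a sufficiently smooth deterministic $\mathbb{R}^r$-valued function of time. The Hamiltonian is $(E_*+KU)^{\mathrm T}X$ with constant $E_*\in\mathbb{R}^n$, $K\in\mathbb{R}^{n\times r}$ (columns $K_1,\ldots,K_r$), and the system-field coupling operators are $MX+N$ with $M\in\mathbb{R}^{m\times n}$, $N\in\mathbb{R}^m$. The system variables obey the Hudson-Parthasarathy quantum stochastic differential equation $$\mathrm{d}X=(AX+b)\mathrm{d}t+2(\Theta\cdot X)M^{\mathrm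 T}\mathrm{d}W,$$ where $b:=2\begin{bmatrix}\Theta_1&\ldots&\Theta_n\end{bmatrix}\mathrm{vec}(M^{\mathrm T}JM\alpha)$, $A(t):=A_*+\mathcal{A}\cdot U(t)$, $\mathcal{A}\in\mathbb{R}^{n\times n\times r}$ has sections $A_k:=2\Theta\diamond K_k$, and $$A_*:=2\Theta\diamond(E_*+M^{\mathrm T}JN)+2\sum_{\ell=1}^n\Theta_\ell M^{\mathrm T}(M\theta_{\ell\bullet\bullet}+JM\,\mathrm{Re}\,\beta_{\ell\bullet\bullet}).$$ Derived quantities. $\mu(t):=\mathbf{E}X(t)$, $\mu_0:=\mu(0)$. $P:=\mathrm{Re}\,\mathbf{E}(X_0X_0^{\mathrm T})=\alpha+\gamma\cdot\mu_0$. $\xi(t):=X(t)-X_0$ and $Q(t):=\mathrm{Re}\,\mathbf{E}(\xi(t)X_0^{\mathrm T})$. For a given matrix $F\in\mathbb{R}^{\nu\times n}$ of full row rank ($\nu\leqslant n$), $\eta(t):=F\xi(t)$, $\Sigma:=F^{\mathrm T}F$, and $\Delta(t):=\mathbf{E}(\eta(t)^{\mathrm T}\eta(t))$ is the mean-square deviation. Put $z(t):=\begin{bmatrix}\mu(t)&P+Q(t)\end{bmatrix}\in\mathbb{R}^{n\times(n+1)}$, $z_0:=z(0)=\begin{bmatrix}\mu_0&P\end{bmatrix}$, $\sigma:=\Sigma\star\gamma=(\langle\Sigma,\gamma_\ell\rangle)_{1\leqslant\ell\leqslant n}$, $R:=\begin{bmatrix}\sigma&-2\Sigma\end{bmatrix}$,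 $c:=b\begin{bmatrix}1&\mu_0^{\mathrm T}\end{bmatrix}$. Known relations: $\Delta(t)=\langle R,z(t)-z_0\rangle$ and $\dot z(t)=A(t)z(t)+c$ with $A(t)=A_*+\mathcal{A}\cdot U(t)$, so that, for a given $z(t)$, $\dot\Delta(t)$ is the function $\langle R,(A_*+\mathcal{A}\cdot U(t))z(t)+c\rangle$ of $U(t)$. *)

theory Defs
  imports "HOL-Analysis.Analysis"
begin

section \<open>Complex Hilbert spaces\<close>

class chilbert = banach +
  fixes scaleC :: "complex \<Rightarrow> 'a \<Rightarrow> 'a" (infixr \<open>*\<^sub>C\<close> 75)
    and cinner :: "'a \<Rightarrow> 'a \<Rightarrow> complex"
  assumes scaleC_add_right: "c *\<^sub>C (x + y) = c *\<^sub>C x + c *\<^sub>C y"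
    and scaleC_add_left: "(c + d) *\<^sub>C x = c *\<^sub>C x + d *\<^sub>C x"
    and scaleC_scaleC: "c *\<^sub>C (d *\<^sub>C x) = (c * d) *\<^sub>C x"
    and scaleC_of_real: "complex_of_real a *\<^sub>C x = a *\<^sub>R x"
    and cinner_commute: "cinner x y = cnj (cinner y x)"
    and cinner_add_right: "cinner x (y + z) = cinner x y + cinner x z"
    and cinner_scaleC_right: "cinner x (c *\<^sub>C y) = c * cinner x y"
    and cinner_self: "cinner x x = complex_of_real ((norm x)\<^sup>2)"

text \<open>
  The direct sum of copies of a Hilbert space \<open>\<FF>\<close> indexed by a finite type is
  the model of \<open>\<complex>\<^sup>d \<otimes> \<FF>\<close> used below.
\<close>

instantiation vec :: (chilbert, finite) chilbert
begin

definition scaleC_vec :: "complex \<Rightarrow> ('a, 'b) vec \<Rightarrow> ('a, 'b) vec"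
  where "scaleC_vec c x = (\<chi> i. c *\<^sub>C (x $ i))"

definition cinner_vec :: "('a, 'b) vec \<Rightarrow> ('a, 'b) vec \<Rightarrow> complex"
  where "cinner_vec x y = (\<Sum>i\<in>UNIV. cinner (x $ i) (y $ i))"

instance
proof
  fix c d :: complex and x y z :: "('a, 'b) vec" and a :: real
  show "c *\<^sub>C (x + y) = c *\<^sub>C x + c *\<^sub>C y"
    by (simp add: scaleC_vec_def vec_eq_iff scaleC_add_right)
  show "(c + d) *\<^sub>C x = c *\<^sub>C x + d *\<^sub>C x"
    by (simp add: scaleC_vec_def vec_eq_iff scaleC_add_left)
  show "c *\<^sub>C (d *\<^sub>C x) = (c * d) *\<^sub>C x"
    by (simp add: scaleC_vec_def vec_eq_iff scaleC_scaleC)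
  show "complex_of_real a *\<^sub>C x = a *\<^sub>R x"
    by (simp add: scaleC_vec_def vec_eq_iff scaleC_of_real)
  have "(\<Sum>i\<in>UNIV. cinner (x $ i) (y $ i)) = (\<Sum>i\<in>UNIV. cnj (cinner (y $ i) (x $ i)))"
    by (intro sum.cong refl cinner_commute)
  then show "cinner x y = cnj (cinner y x)"
    by (simp add: cinner_vec_def)
  show "cinner x (y + z) = cinner x y + cinner x z"
    by (simp add: cinner_vec_def cinner_add_right sum.distrib)
  show "cinner x (c *\<^sub>C y) = c * cinner x y"
    by (simp add: cinner_vec_def scaleC_vec_def cinner_scaleC_right sum_distrib_left)
  show "cinner x x = complex_of_real ((norm x)\<^sup>2)"
    by (simp add: cinner_vec_def cinner_self norm_vec_def L2_set_def sum_nonneg)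
qed

end

definition complex_linear_op :: "('a::chilbert \<Rightarrow> 'b::chilbert) \<Rightarrow> bool"
  where "complex_linear_op T \<longleftrightarrow>
    (\<forall>x y. T (x + y) = T x + T y) \<and> (\<forall>c x. T (c *\<^sub>C x) = c *\<^sub>C T x)"

definition bounded_selfadjoint :: "('a::chilbert \<Rightarrow> 'a) \<Rightarrow> bool"
  where "bounded_selfadjoint T \<longleftrightarrow>
    complex_linear_op T \<and> bounded_linear T \<and> (\<forall>x y. cinner (T x) y = cinner x (T y))"

definition total_set :: "'a::chilbert set \<Rightarrow> bool"
  where "total_set S \<longleftrightarrow> closure (span {c *\<^sub>C x |c x. x \<in> S}) = UNIV"

definition orthonormal_basis :: "'a::chilbert set \<Rightarrow> bool"
  where "orthonormal_basis B \<longleftrightarrow>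
    (\<forall>x\<in>B. \<forall>y\<in>B. cinner x y = (if x = y then 1 else 0)) \<and> total_set B"

text \<open>For trace class operators the value does not depend on the chosen basis.\<close>

definition op_trace :: "('a::chilbert \<Rightarrow> 'a) \<Rightarrow> complex"
  where "op_trace T = (\<Sum>\<^sub>\<infinity>x\<in>(SOME B. orthonormal_basis B). cinner x (T x))"

text \<open>Under the identification of \<open>\<complex>\<^sup>d \<otimes> \<FF>\<close> with \<open>\<FF>\<^sup>d\<close>: the elementary tensor
  \<open>u \<otimes> \<phi>\<close> of vectors, and the tensor product of a matrix with an operator on \<open>\<FF>\<close>.\<close>

definition tensor_vec :: "complex ^ 'd \<Rightarrow> 'f::chilbert \<Rightarrow> 'f ^ 'd"  (infixr \<open>\<otimes>\<^sub>v\<close> 70)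
  where "u \<otimes>\<^sub>v \<phi> = (\<chi> i. (u $ i) *\<^sub>C \<phi>)"

definition tensor_op ::
    "complex ^ 'd ^ 'd \<Rightarrow> ('f::chilbert \<Rightarrow> 'f) \<Rightarrow> 'f ^ 'd \<Rightarrow> 'f ^ 'd"  (infixr \<open>\<otimes>\<^sub>o\<close> 70)
  where "(D \<otimes>\<^sub>o T) \<psi> = (\<chi> i. \<Sum>j\<in>UNIV. (D $ i $ j) *\<^sub>C T (\<psi> $ j))"

definition hermitian_matrix :: "complex ^ 'd ^ 'd \<Rightarrow> bool"
  where "hermitian_matrix D \<longleftrightarrow> (\<forall>i j. D $ i $ j = cnj (D $ j $ i))"

definition density_matrix :: "complex ^ 'd ^ 'd \<Rightarrow> bool"
  where "density_matrix D \<longleftrightarrow> hermitian_matrix D \<and>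
    (\<forall>u :: complex ^ 'd. 0 \<le> Re (\<Sum>i\<in>UNIV. \<Sum>j\<in>UNIV. cnj (u $ i) * D $ i $ j * u $ j)) \<and>
    trace D = 1"

section \<open>Symmetric Fock space and quantum Wiener process\<close>

text \<open>The one-particle space is \<open>L\<^sup>2(\<real>\<^sub>+; \<complex>\<^sup>k)\<close>, where \<open>k\<close> is half of the number
  of components of the quantum Wiener process. Its elements are represented by functions.\<close>

definition L2_half_line :: "(real \<Rightarrow> complex ^ 'k) set"
  where "L2_half_line = {f. f \<in> borel_measurable (lebesgue_on {0..}) \<and>
    integrable (lebesgue_on {0..}) (\<lambda>s. (norm (f s))\<^sup>2)}"

definition L2_inner :: "(real \<Rightarrow> complex ^ 'k) \<Rightarrow> (real \<Rightarrow> complex ^ 'k) \<Rightarrow> complex"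
  where "L2_inner f g = (LINT s|lebesgue_on {0..}. (\<Sum>j\<in>UNIV. cnj (f s $ j) * g s $ j))"

text \<open>The symmetric Fock space over the one-particle space is given together with its
  exponential (coherent) vectors \<open>ex f = \<Oplus>\<^sub>n f\<^bsup>\<otimes>n\<^esup> / sqrt(n!)\<close>; up to a unitary
  isomorphism it is determined by the following two properties.\<close>

definition symmetric_fock_space :: "((real \<Rightarrow> complex ^ 'k) \<Rightarrow> 'f::chilbert) \<Rightarrow> bool"
  where "symmetric_fock_space ex \<longleftrightarrow>
    (\<forall>f\<in>L2_half_line. \<forall>g\<in>L2_half_line. cinner (ex f) (ex g) = exp (L2_inner f g)) \<and>
    total_set (ex ` L2_half_line)"

definition vacuum :: "((real \<Rightarrow> complex ^ 'k) \<Rightarrow> 'f) \<Rightarrow> 'f"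
  where "vacuum ex = ex (\<lambda>s. 0)"

text \<open>The components of the Wiener process are indexed by pairs of a channel and a quadrature,
  with \<open>False\<close> for the first and \<open>True\<close> for the second quadrature. On the exponential domain,
  \<open>W (j, False) = a\<^sub>j + a\<^sub>j\<^sup>\<dagger>\<close> and \<open>W (j, True) = \<i> (a\<^sub>j\<^sup>\<dagger> - a\<^sub>j)\<close> in terms of the
  annihilation and creation processes
  \<open>a\<^sub>j(t) ex g = (\<integral>\<^sub>0\<^sup>t g\<^sub>j) ex g\<close> and
  \<open>a\<^sub>j\<^sup>\<dagger>(t) ex g = d/d\<epsilon> ex (g + \<epsilon> 1\<^bsub>[0,t]\<^esub> e\<^sub>j)\<close> at \<open>\<epsilon> = 0\<close>. Since the only
  nonzero Ito product of their differentials is \<open>da\<^sub>j da\<^sub>j\<^sup>\<dagger> = dt\<close>, this gives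
  \<open>dW dW\<^sup>T = (I + \<i> J) dt\<close> with \<open>J\<close> as below.\<close>

definition channel_indicator :: "'k \<Rightarrow> real \<Rightarrow> real \<Rightarrow> complex ^ 'k"
  where "channel_indicator j t = (\<lambda>s. indicator {0..t} s *\<^sub>R axis j 1)"

definition quantum_wiener_process ::
    "((real \<Rightarrow> complex ^ 'k) \<Rightarrow> 'f::chilbert) \<Rightarrow> (real \<Rightarrow> 'k \<times> bool \<Rightarrow> 'f \<Rightarrow> 'f) \<Rightarrow> bool"
  where "quantum_wiener_process ex W \<longleftrightarrow>
    (\<forall>t\<ge>0. \<forall>j. \<forall>g\<in>L2_half_line. \<exists>ann cre.
       ann = (LINT s|lebesgue_on {0..t}. g s $ j) *\<^sub>C ex g \<and>
       ((\<lambda>\<epsilon>::real. ex (\<lambda>s. g s + \<epsilon> *\<^sub>R channel_indicator j t s)) has_vector_derivative cre) (at 0) \<and>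
       W t (j, False) (ex g) = ann + cre \<and>
       W t (j, True) (ex g) = \<i> *\<^sub>C (cre - ann))"

definition kronecker :: "real ^ 'b ^ 'a \<Rightarrow> real ^ 'd ^ 'c \<Rightarrow> real ^ ('b \<times> 'd) ^ ('a \<times> 'c)"
  where "kronecker A B = (\<chi> i j. A $ fst i $ fst j * B $ snd i $ snd j)"

definition J2 :: "real ^ bool ^ bool"
  where "J2 = (\<chi> i j. if i = j then 0 else if j then 1 else - 1)"

definition Jmat :: "real ^ ('k::finite \<times> bool) ^ ('k \<times> bool)"
  where "Jmat = kronecker (mat 1) J2"

text \<open>Adaptedness: an operator at time \<open>t\<close> acts trivially on the factor of the Fock space
  associated with \<open>(t, \<infinity>)\<close>.\<close>

definition before :: "real \<Rightarrow> (real \<Rightarrow> complex ^ 'k) \<Rightarrow> real \<Rightarrow> complex ^ 'k"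
  where "before t f = (\<lambda>s. indicator {..t} s *\<^sub>R f s)"

definition after :: "real \<Rightarrow> (real \<Rightarrow> complex ^ 'k) \<Rightarrow> real \<Rightarrow> complex ^ 'k"
  where "after t f = (\<lambda>s. indicator {t<..} s *\<^sub>R f s)"

definition adapted_at ::
    "((real \<Rightarrow> complex ^ 'k) \<Rightarrow> 'f::chilbert) \<Rightarrow> real \<Rightarrow> ('f ^ 'd \<Rightarrow> 'f ^ 'd) \<Rightarrow> bool"
  where "adapted_at ex t T \<longleftrightarrow>
    (\<forall>u v. \<forall>f\<in>L2_half_line. \<forall>g\<in>L2_half_line.
       cinner (u \<otimes>\<^sub>v ex f) (T (v \<otimes>\<^sub>v ex g)) =
       cinner (u \<otimes>\<^sub>v ex (before t f)) (T (v \<otimes>\<^sub>v ex (before t g)))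
         * cinner (ex (after t f)) (ex (after t g)))"

text \<open>\<open>\<integral>\<^sub>0\<^sup>t G(s) dW\<^sub>k(s)\<close> evaluated at \<open>u \<otimes> ex g\<close>, as a limit of left-endpoint Ito sums.
  For bounded, adapted and strongly continuous integrands this is the Hudson-Parthasarathy
  integral.\<close>

definition has_ito_integral ::
    "((real \<Rightarrow> complex ^ 'k) \<Rightarrow> 'f::chilbert) \<Rightarrow> (real \<Rightarrow> 'k \<times> bool \<Rightarrow> 'f \<Rightarrow> 'f) \<Rightarrow> 'k \<times> bool
      \<Rightarrow> (real \<Rightarrow> 'f ^ 'd \<Rightarrow> 'f ^ 'd) \<Rightarrow> real \<Rightarrow> complex ^ 'd \<Rightarrow> (real \<Rightarrow> complex ^ 'k)
      \<Rightarrow> 'f ^ 'd \<Rightarrow> bool"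
  where "has_ito_integral ex W k G t u g I \<longleftrightarrow>
    (\<lambda>N. \<Sum>i<N. G (t * real i / real N)
        (u \<otimes>\<^sub>v (W (t * real (Suc i) / real N) k (ex g) - W (t * real i / real N) k (ex g))))
      \<longlonglongrightarrow> I"

section \<open>Arrays\<close>

text \<open>A three-index array \<open>T\<close> is stored as the family of its sections:
  \<open>T $ l $ j $ k\<close> is the entry \<open>T\<^sub>j\<^sub>k\<^sub>l\<close>.\<close>

definition array_dot :: "real ^ 'q ^ 'p ^ 's \<Rightarrow> real ^ 's \<Rightarrow> real ^ 'q ^ 'p"  (infixl \<open>\<cdot>\<^sub>a\<close> 70)
  where "T \<cdot>\<^sub>a w = (\<Sum>l\<in>UNIV. (w $ l) *\<^sub>R (T $ l))"

definition first_slice :: "'a ^ 'k ^ 'j ^ 'm \<Rightarrow> 'j \<Rightarrow> 'a ^ 'm ^ 'k"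
  where "first_slice T l = (\<chi> j k. T $ k $ l $ j)"

definition diamond :: "real ^ 'n ^ 'n ^ 'n \<Rightarrow> real ^ 'n \<Rightarrow> real ^ 'n ^ 'n"  (infixl \<open>\<diamondop>\<close> 70)
  where "T \<diamondop> u = (\<chi> j l. ((T $ l) *v u) $ j)"

text \<open>The inner product of nested vectors is the Frobenius inner product of matrices.\<close>

definition star :: "real ^ 'q ^ 'p \<Rightarrow> real ^ 'q ^ 'p ^ 's \<Rightarrow> real ^ 's"  (infixl \<open>\<star>\<close> 70)
  where "u \<star> T = (\<chi> k. inner u (T $ k))"

text \<open>Column stacking: the column index is the leading component of the index.\<close>

definition vectorize :: "'a ^ 'q ^ 'p \<Rightarrow> 'a ^ ('q \<times> 'p)"
  where "vectorize A = (\<chi> i. A $ snd i $ fst i)"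

definition block_row :: "'a ^ 'q ^ 'p ^ 's \<Rightarrow> 'a ^ ('s \<times> 'q) ^ 'p"
  where "block_row T = (\<chi> j i. T $ fst i $ j $ snd i)"

definition Re_array :: "complex ^ 'n ^ 'n ^ 'n \<Rightarrow> real ^ 'n ^ 'n ^ 'n"
  where "Re_array \<beta> = (\<chi> l j k. Re (\<beta> $ l $ j $ k))"

definition Im_array :: "complex ^ 'n ^ 'n ^ 'n \<Rightarrow> real ^ 'n ^ 'n ^ 'n"
  where "Im_array \<beta> = (\<chi> l j k. Im (\<beta> $ l $ j $ k))"

definition weighted_norm_sq :: "real ^ 'r ^ 'r \<Rightarrow> real ^ 'r \<Rightarrow> real"
  where "weighted_norm_sq S u = inner u (S *v u)"

definition pos_def :: "real ^ 'r ^ 'r \<Rightarrow> bool"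
  where "pos_def S \<longleftrightarrow> transpose S = S \<and> (\<forall>u. u \<noteq> 0 \<longrightarrow> 0 < inner u (S *v u))"

section \<open>The open quantum memory system\<close>

definition drift_vec ::
    "real ^ 'n ^ 'n \<Rightarrow> complex ^ 'n ^ 'n ^ 'n \<Rightarrow> real ^ 'n ^ ('k::finite \<times> bool) \<Rightarrow> real ^ 'n"
  where "drift_vec \<alpha> \<beta> M =
    2 *\<^sub>R (block_row (Im_array \<beta>) *v vectorize (transpose M ** Jmat ** M ** \<alpha>))"

definition A_star ::
    "complex ^ 'n ^ 'n ^ 'n \<Rightarrow> real ^ 'n \<Rightarrow> real ^ 'n ^ ('k::finite \<times> bool) \<Rightarrow> real ^ ('k \<times> bool)
      \<Rightarrow> real ^ 'n ^ 'n"
  where "A_star \<beta> E M N =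
    2 *\<^sub>R (Im_array \<beta> \<diamondop> (E + transpose M *v (Jmat *v N))) +
    2 *\<^sub>R (\<Sum>l\<in>UNIV. (Im_array \<beta> $ l) ** transpose M **
      (M ** first_slice (Im_array \<beta>) l + Jmat ** M ** first_slice (Re_array \<beta>) l))"

definition A_array :: "complex ^ 'n ^ 'n ^ 'n \<Rightarrow> real ^ 'r ^ 'n \<Rightarrow> real ^ 'n ^ 'n ^ 'r"
  where "A_array \<beta> K = (\<chi> k. 2 *\<^sub>R (Im_array \<beta> \<diamondop> column k K))"

text \<open>\<open>X t j\<close> is the \<open>j\<close>-th system variable at time \<open>t\<close>.\<close>

definition algebraic_relations ::
    "real ^ 'n ^ 'n \<Rightarrow> complex ^ 'n ^ 'n ^ 'n \<Rightarrow> ('n \<Rightarrow> 'h::chilbert \<Rightarrow> 'h) \<Rightarrow> bool"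
  where "algebraic_relations \<alpha> \<beta> Y \<longleftrightarrow>
    (\<forall>j k \<psi>. Y j (Y k \<psi>) = (\<alpha> $ j $ k) *\<^sub>R \<psi> + (\<Sum>l\<in>UNIV. (\<beta> $ l $ j $ k) *\<^sub>C Y l \<psi>))"

text \<open>The entries of the dispersion matrix \<open>2 (\<Theta> \<cdot> Y) M\<^sup>T\<close>.\<close>

definition dispersion ::
    "complex ^ 'n ^ 'n ^ 'n \<Rightarrow> real ^ 'n ^ ('k::finite \<times> bool) \<Rightarrow> ('n \<Rightarrow> 'h::chilbert \<Rightarrow> 'h)
      \<Rightarrow> 'n \<Rightarrow> 'k \<times> bool \<Rightarrow> 'h \<Rightarrow> 'h"
  where "dispersion \<beta> M Y j k \<psi> =
    (\<Sum>l\<in>UNIV. (2 * ((Im_array \<beta> $ l) ** transpose M) $ j $ k) *\<^sub>R Y l \<psi>)"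

text \<open>The equation \<open>dX = (A X + b) dt + 2 (\<Theta> \<cdot> X) M\<^sup>T dW\<close> in integral form on the
  exponential domain, including adaptedness of the solution.\<close>

definition solves_qsde ::
    "((real \<Rightarrow> complex ^ 'k) \<Rightarrow> 'f::chilbert) \<Rightarrow> (real \<Rightarrow> 'k \<times> bool \<Rightarrow> 'f \<Rightarrow> 'f)
      \<Rightarrow> (real \<Rightarrow> real ^ 'n ^ 'n) \<Rightarrow> real ^ 'n \<Rightarrow> complex ^ 'n ^ 'n ^ 'n \<Rightarrow> real ^ 'n ^ ('k \<times> bool)
      \<Rightarrow> (real \<Rightarrow> 'n \<Rightarrow> 'f ^ 'd \<Rightarrow> 'f ^ 'd) \<Rightarrow> bool"
  where "solves_qsde ex W A b \<beta> M X \<longleftrightarrow>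
    (\<forall>t\<ge>0. \<forall>j. adapted_at ex t (X t j)) \<and>
    (\<forall>t\<ge>0. \<forall>j u. \<forall>g\<in>L2_half_line. \<exists>D I.
       ((\<lambda>s. (\<Sum>l\<in>UNIV. (A s $ j $ l) *\<^sub>R X s l (u \<otimes>\<^sub>v ex g)) + (b $ j) *\<^sub>R (u \<otimes>\<^sub>v ex g))
          has_integral D) {0..t} \<and>
       (\<forall>k. has_ito_integral ex W k (\<lambda>s. dispersion \<beta> M (X s) j k) t u g (I k)) \<and>
       X t j (u \<otimes>\<^sub>v ex g) = X 0 j (u \<otimes>\<^sub>v ex g) + D + (\<Sum>k\<in>UNIV. I k))"

section \<open>Derived quantities\<close>

text \<open>The state \<open>\<rho>\<^sub>0 \<otimes> \<upsilon>\<close> with the vacuum state \<open>\<upsilon>\<close> as a rank one projection.\<close>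

definition system_state ::
    "((real \<Rightarrow> complex ^ 'k) \<Rightarrow> 'f::chilbert) \<Rightarrow> complex ^ 'd ^ 'd \<Rightarrow> 'f ^ 'd \<Rightarrow> 'f ^ 'd"
  where "system_state ex \<rho>0 = \<rho>0 \<otimes>\<^sub>o (\<lambda>\<phi>. cinner (vacuum ex) \<phi> *\<^sub>C vacuum ex)"

definition expect ::
    "((real \<Rightarrow> complex ^ 'k) \<Rightarrow> 'f::chilbert) \<Rightarrow> complex ^ 'd ^ 'd \<Rightarrow> ('f ^ 'd \<Rightarrow> 'f ^ 'd) \<Rightarrow> complex"
  where "expect ex \<rho>0 \<zeta> = op_trace (system_state ex \<rho>0 \<circ> \<zeta>)"

text \<open>The expectations in \<open>mean\<close> and \<open>deviation\<close> are those of self-adjoint operators, so taking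
  the real part only changes the type.\<close>

definition mean ::
    "((real \<Rightarrow> complex ^ 'k) \<Rightarrow> 'f::chilbert) \<Rightarrow> complex ^ 'd ^ 'd
      \<Rightarrow> (real \<Rightarrow> 'n \<Rightarrow> 'f ^ 'd \<Rightarrow> 'f ^ 'd) \<Rightarrow> real \<Rightarrow> real ^ 'n"
  where "mean ex \<rho>0 X t = (\<chi> j. Re (expect ex \<rho>0 (X t j)))"

definition increment ::
    "(real \<Rightarrow> 'n \<Rightarrow> 'h::chilbert \<Rightarrow> 'h) \<Rightarrow> real \<Rightarrow> 'n \<Rightarrow> 'h \<Rightarrow> 'h"
  where "increment X t j = (\<lambda>\<psi>. X t j \<psi> - X 0 j \<psi>)"

definition P_mat ::
    "((real \<Rightarrow> complex ^ 'k) \<Rightarrow> 'f::chilbert) \<Rightarrow> complex ^ 'd ^ 'd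
      \<Rightarrow> (real \<Rightarrow> 'n \<Rightarrow> 'f ^ 'd \<Rightarrow> 'f ^ 'd) \<Rightarrow> real ^ 'n ^ 'n"
  where "P_mat ex \<rho>0 X = (\<chi> j k. Re (expect ex \<rho>0 (X 0 j \<circ> X 0 k)))"

definition Q_mat ::
    "((real \<Rightarrow> complex ^ 'k) \<Rightarrow> 'f::chilbert) \<Rightarrow> complex ^ 'd ^ 'd
      \<Rightarrow> (real \<Rightarrow> 'n \<Rightarrow> 'f ^ 'd \<Rightarrow> 'f ^ 'd) \<Rightarrow> real \<Rightarrow> real ^ 'n ^ 'n"
  where "Q_mat ex \<rho>0 X t = (\<chi> j k. Re (expect ex \<rho>0 (increment X t j \<circ> X 0 k)))"

definition output_dev ::
    "real ^ 'n ^ 'v \<Rightarrow> (real \<Rightarrow> 'n \<Rightarrow> 'h::chilbert \<Rightarrow> 'h) \<Rightarrow> real \<Rightarrow> 'v \<Rightarrow> 'h \<Rightarrow> 'h"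
  where "output_dev F X t a = (\<lambda>\<psi>. \<Sum>j\<in>UNIV. (F $ a $ j) *\<^sub>R increment X t j \<psi>)"

definition deviation ::
    "((real \<Rightarrow> complex ^ 'k) \<Rightarrow> 'f::chilbert) \<Rightarrow> complex ^ 'd ^ 'd
      \<Rightarrow> real ^ 'n ^ 'v \<Rightarrow> (real \<Rightarrow> 'n \<Rightarrow> 'f ^ 'd \<Rightarrow> 'f ^ 'd) \<Rightarrow> real \<Rightarrow> real"
  where "deviation ex \<rho>0 F X t =
    Re (expect ex \<rho>0 (\<lambda>\<psi>. \<Sum>a\<in>UNIV. output_dev F X t a (output_dev F X t a \<psi>)))"

text \<open>An \<open>n \<times> (n + 1)\<close> matrix with its leading column separated; the column indices are
  \<open>None\<close> for the leading column and \<open>Some k\<close> for the others.\<close>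

definition join_column :: "real ^ 'n \<Rightarrow> real ^ 'n ^ 'n \<Rightarrow> real ^ 'n option ^ 'n"
  where "join_column u S = (\<chi> j i. case i of None \<Rightarrow> u $ j | Some k \<Rightarrow> S $ j $ k)"

definition z_mat ::
    "((real \<Rightarrow> complex ^ 'k) \<Rightarrow> 'f::chilbert) \<Rightarrow> complex ^ 'd ^ 'd
      \<Rightarrow> (real \<Rightarrow> 'n \<Rightarrow> 'f ^ 'd \<Rightarrow> 'f ^ 'd) \<Rightarrow> real \<Rightarrow> real ^ 'n option ^ 'n"
  where "z_mat ex \<rho>0 X t = join_column (mean ex \<rho>0 X t) (P_mat ex \<rho>0 X + Q_mat ex \<rho>0 X t)"

definition R_mat :: "complex ^ 'n ^ 'n ^ 'n \<Rightarrow> real ^ 'n ^ 'v \<Rightarrow> real ^ 'n option ^ 'n"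
  where "R_mat \<beta> F =
    (let \<Sigma> = transpose F ** F in join_column (\<Sigma> \<star> Re_array \<beta>) (- (2 *\<^sub>R \<Sigma>)))"

definition c_mat :: "real ^ 'n \<Rightarrow> real ^ 'n \<Rightarrow> real ^ 'n option ^ 'n"
  where "c_mat b \<mu>0 = join_column b (\<chi> j k. b $ j * \<mu>0 $ k)"

text \<open>With \<open>R\<close>, \<open>c\<close>, \<open>A\<^sub>*\<close> and the array \<open>\<A>\<close> as arguments: the functions \<open>f\<close> and \<open>g\<close>, and the time
  derivative of the mean-square deviation as a function of the current matrix \<open>v = z(t)\<close> and
  the current control value \<open>u = U(t)\<close>.\<close>

definition f_fun ::
    "real ^ 'n option ^ 'n \<Rightarrow> real ^ 'n option ^ 'n \<Rightarrow> real ^ 'n ^ 'n \<Rightarrow> real ^ 'n option ^ 'n \<Rightarrow> real"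
  where "f_fun R c As v = inner R (As ** v + c)"

definition g_fun ::
    "real ^ 'n option ^ 'n \<Rightarrow> real ^ 'n ^ 'n ^ 'r \<Rightarrow> real ^ 'n option ^ 'n \<Rightarrow> real ^ 'r"
  where "g_fun R \<A> v = (R ** transpose v) \<star> \<A>"

definition deviation_rate ::
    "real ^ 'n option ^ 'n \<Rightarrow> real ^ 'n option ^ 'n \<Rightarrow> real ^ 'n ^ 'n \<Rightarrow> real ^ 'n ^ 'n ^ 'r
      \<Rightarrow> real ^ 'n option ^ 'n \<Rightarrow> real ^ 'r \<Rightarrow> real"
  where "deviation_rate R c As \<A> v u = inner R ((As + \<A> \<cdot>\<^sub>a u) ** v + c)"

end

theory Submission
  imports Defs
begin

text \<open>
  An expectation in the state \<open>\<rho>\<^sub>0 \<otimes> \<upsilon>\<close> is, by Parseval's identity, a finite combination of matrix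
  elements between vectors \<open>u \<otimes> vacuum\<close>. There the Ito integrals vanish: by adaptedness, an
  operator at time \<open>s\<close> does not see the difference of the indicators of \<open>[0, s]\<close> and \<open>[0, s']\<close> that
  generates \<open>W(s') - W(s)\<close>. Hence the mean values and the correlations with the initial variables
  solve the linear equation \<open>z' = A z + c\<close>. The algebraic relations make the deviation an affine
  function of \<open>z\<close>, so that its rate is affine in the control with gradient \<open>g(z)\<close>, and the
  penalised rate is minimised by completing the square.
\<close>

section \<open>Hilbert space geometry\<close>

lemma cinner_add_left: "cinner (x + y) z = cinner x z + cinner y z"
  for x y z :: "'a::chilbert"
  by (metis cinner_add_right cinner_commute complex_cnj_add)

lemma cinner_scaleC_left: "cinner (c *\<^sub>C x) y = cnj c * cinner x y"
  for x y :: "'a::chilbert"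
  by (metis cinner_scaleC_right cinner_commute complex_cnj_mult)

lemma cinner_scaleR_right: "cinner x (r *\<^sub>R y) = of_real r * cinner x y"
  for x y :: "'a::chilbert"
  by (metis cinner_scaleC_right scaleC_of_real)

lemma cinner_scaleR_left: "cinner (r *\<^sub>R x) y = of_real r * cinner x y"
  for x y :: "'a::chilbert"
  by (metis cinner_scaleC_left scaleC_of_real complex_cnj_complex_of_real)

lemma cinner_zero_right [simp]: "cinner x 0 = 0" for x :: "'a::chilbert"
  using cinner_scaleR_right[of x 0 0] by simp

lemma cinner_zero_left [simp]: "cinner 0 x = 0" for x :: "'a::chilbert"
  using cinner_scaleR_left[of 0 0 x] by simp

lemma cinner_minus_right: "cinner x (- y) = - cinner x y" for x y :: "'a::chilbert"
  using cinner_scaleR_right[of x "-1" y] by simp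

lemma cinner_minus_left: "cinner (- x) y = - cinner x y" for x y :: "'a::chilbert"
  using cinner_scaleR_left[of "-1" x y] by simp

lemma cinner_diff_right: "cinner x (y - z) = cinner x y - cinner x z"
  for x y z :: "'a::chilbert"
  using cinner_add_right[of x y "- z"] by (simp add: cinner_minus_right)

lemma cinner_diff_left: "cinner (x - y) z = cinner x z - cinner y z"
  for x y z :: "'a::chilbert"
  using cinner_add_left[of x "- y" z] by (simp add: cinner_minus_left)

lemma cinner_sum_right: "cinner x (\<Sum>i\<in>A. h i) = (\<Sum>i\<in>A. cinner x (h i))"
  for x :: "'a::chilbert"
  by (induction A rule: infinite_finite_induct) (auto simp: cinner_add_right)

lemma cinner_sum_left: "cinner (\<Sum>i\<in>A. h i) x = (\<Sum>i\<in>A. cinner (h i) x)"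
  for x :: "'a::chilbert"
  by (induction A rule: infinite_finite_induct) (auto simp: cinner_add_left)

lemma scaleC_diff_right: "c *\<^sub>C (x - y) = c *\<^sub>C x - c *\<^sub>C y" for x y :: "'a::chilbert"
  by (metis add_diff_cancel diff_add_cancel scaleC_add_right)

lemma scaleC_zero_right [simp]: "c *\<^sub>C 0 = (0 :: 'a::chilbert)"
  using scaleC_diff_right[of c 0 0] by simp

lemma scaleC_zero_left [simp]: "0 *\<^sub>C x = (0 :: 'a::chilbert)"
  using scaleC_of_real[of 0 x] by simp

lemma scaleC_one [simp]: "1 *\<^sub>C x = (x :: 'a::chilbert)"
  using scaleC_of_real[of 1 x] by simp

lemma scaleC_sum_right: "c *\<^sub>C (\<Sum>i\<in>A. h i) = (\<Sum>i\<in>A. c *\<^sub>C (h i :: 'a::chilbert))"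
  by (induction A rule: infinite_finite_induct) (auto simp: scaleC_add_right)

lemma norm_add_orthogonal:
  fixes x y :: "'a::chilbert"
  assumes "cinner x y = 0"
  shows "(norm (x + y))\<^sup>2 = (norm x)\<^sup>2 + (norm y)\<^sup>2"
proof -
  have "cinner y x = 0"
    using assms cinner_commute[of y x] by simp
  then have "complex_of_real ((norm (x + y))\<^sup>2) = of_real ((norm x)\<^sup>2 + (norm y)\<^sup>2)"
    using assms unfolding cinner_self[symmetric] of_real_add
    by (simp add: cinner_add_left cinner_add_right)
  then show ?thesis
    using of_real_eq_iff by blast
qed

text \<open>The class ties the norm to real scalars only; homogeneity for complex scalars is read
  off \<open>cinner_self\<close>.\<close>

lemma norm_scaleC: "norm (c *\<^sub>C x) = norm c * norm (x :: 'a::chilbert)"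
proof -
  have "complex_of_real ((norm (c *\<^sub>C x))\<^sup>2) = cnj c * c * of_real ((norm x)\<^sup>2)"
    unfolding cinner_self[symmetric] by (simp add: cinner_scaleC_left cinner_scaleC_right)
  also have "\<dots> = of_real ((norm c * norm x)\<^sup>2)"
    by (simp add: power_mult_distrib complex_norm_square mult.commute del: of_real_power)
  finally have "(norm (c *\<^sub>C x))\<^sup>2 = (norm c * norm x)\<^sup>2"
    using of_real_eq_iff by blast
  then show ?thesis
    by (simp add: power2_eq_iff_nonneg)
qed

section \<open>Orthonormal sets and projections onto finite parts of them\<close>

text \<open>The condition of \<open>orthonormal_basis\<close> without totality: the property to
  which Zorn's lemma is applied.\<close>

definition orthonormal_set :: "'a::chilbert set \<Rightarrow> bool"
  where "orthonormal_set B \<longleftrightarrow> (\<forall>x\<in>B. \<forall>y\<in>B. cinner x y = (if x = y then 1 else 0))"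

lemma norm_sum_orthonormal:
  fixes B :: "'a::chilbert set"
  assumes B: "orthonormal_set B" and F: "finite F" "F \<subseteq> B"
  shows "(norm (\<Sum>x\<in>F. a x *\<^sub>C x))\<^sup>2 = (\<Sum>x\<in>F. (norm (a x))\<^sup>2)"
  using F
proof (induction F rule: finite_induct)
  case (insert y F)
  have "cinner y x = 0" if "x \<in> F" for x
    using that insert.hyps insert.prems B unfolding orthonormal_set_def by force
  then have "cinner (a y *\<^sub>C y) (\<Sum>x\<in>F. a x *\<^sub>C x) = 0"
    by (simp add: cinner_sum_right cinner_scaleC_left cinner_scaleC_right)
  moreover have "norm y = 1"
  proof -
    have "complex_of_real ((norm y)\<^sup>2) = of_real 1"
      using B insert.prems cinner_self[of y] by (simp add: orthonormal_set_def)
    then have "(norm y)\<^sup>2 = 1"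
      using of_real_eq_iff by blast
    then show ?thesis
      by (simp add: power2_eq_1_iff) (smt (verit) norm_ge_zero)
  qed
  ultimately show ?case
    using insert by (simp add: norm_add_orthogonal norm_scaleC)
qed simp

text \<open>For a finite part \<open>F\<close> of an orthonormal set this is the orthogonal
  projection onto its complex span, and also the partial Fourier sum over \<open>F\<close>.\<close>

definition proj :: "'a::chilbert set \<Rightarrow> 'a \<Rightarrow> 'a"
  where "proj F y = (\<Sum>x\<in>F. cinner x y *\<^sub>C x)"

lemma proj_add: "proj F (x + y) = proj F x + proj F y"
  by (simp add: proj_def cinner_add_right scaleC_add_left sum.distrib)

lemma proj_scaleC: "proj F (c *\<^sub>C y) = c *\<^sub>C proj F y"
  by (simp add: proj_def cinner_scaleC_right scaleC_scaleC scaleC_sum_right)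

lemma proj_scaleR: "proj F (r *\<^sub>R y) = r *\<^sub>R proj F y"
  using proj_scaleC[of F "of_real r" y] by (simp add: scaleC_of_real)

lemma proj_diff: "proj F (x - y) = proj F x - proj F y"
  by (metis add_diff_cancel diff_add_cancel proj_add)

lemma cinner_proj_member:
  assumes "orthonormal_set B" "finite F" "F \<subseteq> B" "x \<in> F"
  shows "cinner x (proj F y) = cinner x y"
proof -
  have "cinner x (proj F y) = (\<Sum>w\<in>F. if x = w then cinner w y else 0)"
    unfolding proj_def cinner_sum_right
    by (intro sum.cong refl)
      (use assms in \<open>auto simp: orthonormal_set_def cinner_scaleC_right subset_iff\<close>)
  then show ?thesis
    using assms by simp
qed

lemma norm_proj:
  assumes "orthonormal_set B" "finite F" "F \<subseteq> B"
  shows "(norm (proj F y))\<^sup>2 = (\<Sum>x\<in>F. (norm (cinner x y))\<^sup>2)"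
  unfolding proj_def by (rule norm_sum_orthonormal[OF assms])

text \<open>Bessel's inequality: the residual \<open>y - proj F y\<close> is orthogonal to
  \<open>proj F y\<close>, so Pythagoras applies.\<close>

lemma norm_proj_le:
  assumes "orthonormal_set B" "finite F" "F \<subseteq> B"
  shows "norm (proj F y) \<le> norm y"
proof -
  have "cinner (proj F y) (y - proj F y) = (\<Sum>x\<in>F. cnj (cinner x y) * cinner x (y - proj F y))"
    by (subst (1) proj_def) (simp add: cinner_sum_left cinner_scaleC_left)
  also have "\<dots> = 0"
    by (intro sum.neutral) (use assms in \<open>simp add: cinner_diff_right cinner_proj_member\<close>)
  finally have "(norm y)\<^sup>2 = (norm (proj F y))\<^sup>2 + (norm (y - proj F y))\<^sup>2"
    using norm_add_orthogonal[of "proj F y" "y - proj F y"] by simp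
  then have "(norm (proj F y))\<^sup>2 \<le> (norm y)\<^sup>2"
    by simp
  then show ?thesis
    by (simp add: power2_le_iff_abs_le)
qed

text \<open>Cauchy-Schwarz, as Bessel's inequality for the single unit vector in the direction of
  \<open>x\<close>.\<close>

lemma norm_cinner_le: "norm (cinner x y) \<le> norm x * norm y" for x y :: "'a::chilbert"
proof (cases "x = 0")
  case False
  define e where "e = (1 / norm x) *\<^sub>R x"
  have xe: "x = norm x *\<^sub>R e" "norm e = 1"
    using False by (auto simp: e_def)
  have "orthonormal_set {e}"
    using xe by (simp add: orthonormal_set_def cinner_self)
  from norm_proj_le[OF this, of "{e}" y] have "norm (cinner e y) \<le> norm y"
    using xe by (simp add: proj_def norm_scaleC)
  then have "norm x * norm (cinner e y) \<le> norm x * norm y"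
    by (simp add: mult_left_mono)
  moreover have "norm (cinner x y) = norm x * norm (cinner e y)"
    by (subst xe(1)) (simp add: cinner_scaleR_left norm_mult)
  ultimately show ?thesis
    by simp
qed simp

lemma bounded_linear_cinner: "bounded_linear (cinner x)" for x :: "'a::chilbert"
proof (rule bounded_linear_intro[where K = "norm x"])
  show "cinner x (r *\<^sub>R y) = r *\<^sub>R cinner x y" for r y
    by (simp add: cinner_scaleR_right scaleR_conv_of_real)
  show "norm (cinner x y) \<le> norm y * norm x" for y
    using norm_cinner_le[of x y] by (simp add: mult.commute)
qed (simp add: cinner_add_right)

section \<open>Fourier series and Parseval's identity\<close>

text \<open>A vector in the span involves finitely many members of \<open>B\<close>, and
  \<open>proj F\<close> fixes it once \<open>F\<close> contains them. \<open>span\<close> is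
  real-linear, which is why its generators are all complex multiples.\<close>

lemma proj_eventually_id:
  assumes B: "orthonormal_set B" and s: "s \<in> span {c *\<^sub>C x |c x. x \<in> B}"
  shows "eventually (\<lambda>F. proj F s = s) (finite_subsets_at_top B)"
  using s
proof (induction rule: span_induct_alt)
  case base
  then show ?case by (simp add: proj_def)
next
  case (step r v y)
  then obtain c x where v: "v = c *\<^sub>C x" "x \<in> B"
    by auto
  have "eventually (\<lambda>F. finite F \<and> F \<subseteq> B \<and> x \<in> F) (finite_subsets_at_top B)"
    unfolding eventually_finite_subsets_at_top using v by (intro exI[of _ "{x}"]) auto
  with step.IH show ?case
  proof eventually_elim
    case (elim F)
    have "proj F x = (\<Sum>w\<in>F. if w = x then x else 0)"
      unfolding proj_def
      by (intro sum.cong refl) (use elim B v in \<open>auto simp: orthonormal_set_def subset_iff\<close>)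
    then have "proj F x = x"
      using elim by simp
    then show ?case
      using elim v by (simp add: proj_add proj_scaleR proj_scaleC)
  qed
qed

text \<open>Approximate \<open>y\<close> by some \<open>s\<close> in the span. Large projections fix
  \<open>s\<close> and by Bessel do not enlarge \<open>y - s\<close>, so the error is at most twice
  the distance from \<open>s\<close> to \<open>y\<close>.\<close>

lemma has_sum_orthonormal_basis:
  assumes B: "orthonormal_basis B"
  shows "((\<lambda>x. cinner x y *\<^sub>C x) has_sum y) B"
  unfolding has_sum_def tendsto_iff
proof safe
  fix e :: real
  assume "e > 0"
  have ons: "orthonormal_set B"
    using B by (simp add: orthonormal_basis_def orthonormal_set_def)
  have "y \<in> closure (span {c *\<^sub>C x |c x. x \<in> B})"
    using B by (auto simp: orthonormal_basis_def total_set_def)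
  then obtain s where s: "s \<in> span {c *\<^sub>C x |c x. x \<in> B}" "dist s y < e / 2"
    using \<open>e > 0\<close> by (meson closure_approachable half_gt_zero)
  have "eventually (\<lambda>F. finite F \<and> F \<subseteq> B) (finite_subsets_at_top B)"
    by (rule eventually_finite_subsets_at_top_weakI) simp
  with proj_eventually_id[OF ons s(1)]
  show "eventually (\<lambda>F. dist (\<Sum>x\<in>F. cinner x y *\<^sub>C x) y < e) (finite_subsets_at_top B)"
  proof eventually_elim
    case (elim F)
    have "proj F y - y = proj F (y - s) + (s - y)"
      using elim by (simp add: proj_diff)
    then have "norm (proj F y - y) \<le> norm (proj F (y - s)) + norm (s - y)"
      by (metis norm_triangle_ineq)
    also have "norm (proj F (y - s)) \<le> norm (y - s)"
      using norm_proj_le[OF ons] elim by blast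
    finally show ?case
      using s(2) by (simp add: proj_def dist_norm norm_minus_commute)
  qed
qed

text \<open>The bounded functional \<open>cinner a\<close> is applied termwise to the Fourier series
  of \<open>y\<close>.\<close>

lemma parseval:
  assumes "orthonormal_basis B"
  shows "((\<lambda>x. cinner x y * cinner a x) has_sum cinner a y) B"
  using has_sum_bounded_linear[OF bounded_linear_cinner has_sum_orthonormal_basis[OF assms]]
  by (simp add: cinner_scaleC_right)

text \<open>By Bessel the squared coefficients are summable, and by Pythagoras their tails control
  the partial sums, which are therefore Cauchy. Without totality the limit may differ from
  \<open>y\<close>.\<close>

lemma orthonormal_set_summable:
  assumes B: "orthonormal_set B"
  shows "(\<lambda>x. cinner x y *\<^sub>C x) summable_on B"
proof -
  let ?f = "\<lambda>x. cinner x y *\<^sub>C x" and ?g = "\<lambda>x. (norm (cinner x y))\<^sup>2"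
  have bound: "sum ?g F \<le> (norm y)\<^sup>2" if "finite F" "F \<subseteq> B" for F
    using norm_proj_le[OF B that, of y] unfolding norm_proj[OF B that, symmetric] by simp
  have "?g summable_on B"
    by (rule nonneg_bdd_above_summable_on) (auto intro!: bdd_aboveI[of _ "(norm y)\<^sup>2"] bound)
  then obtain L where L: "(?g has_sum L) B"
    using summable_on_def by blast
  have "cauchy_filter (filtermap (sum ?f) (finite_subsets_at_top B))"
    unfolding cauchy_filter_metric_filtermap
  proof (intro allI impI)
    fix e :: real
    assume "e > 0"
    then have "eventually (\<lambda>F. dist (sum ?g F) L < (e / 2)\<^sup>2) (finite_subsets_at_top B)"
      using L unfolding has_sum_def tendsto_iff by auto
    then obtain F0 where F0: "finite F0" "F0 \<subseteq> B" "dist (sum ?g F0) L < (e / 2)\<^sup>2"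
      unfolding eventually_finite_subsets_at_top by blast
    \<comment> \<open>\<open>F0\<close> leaves less than \<open>(e / 2)\<^sup>2\<close> of the total
      \<open>L\<close>, so enlarging it changes the vector sum by less than \<open>e / 2\<close>;
      two enlargements are then compared through \<open>F0\<close>.\<close>
    have close: "dist (sum ?f F) (sum ?f F0) < e / 2" if F: "finite F" "F0 \<subseteq> F" "F \<subseteq> B" for F
    proof -
      have "(dist (sum ?f F) (sum ?f F0))\<^sup>2 = (norm (sum ?f (F - F0)))\<^sup>2"
        using F by (simp add: dist_norm sum_diff)
      also have "\<dots> = sum ?g (F - F0)"
        by (rule norm_sum_orthonormal[OF B]) (use F in auto)
      also have "\<dots> = sum ?g F - sum ?g F0"
        using F by (simp add: sum_diff)
      also have "\<dots> \<le> L - sum ?g F0"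
        using finite_sum_le_has_sum[OF L, of F] F by simp
      also have "\<dots> < (e / 2)\<^sup>2"
        using F0 by (simp add: dist_real_def)
      finally show ?thesis
        by (rule power_less_imp_less_base) (use \<open>e > 0\<close> in simp)
    qed
    show "\<exists>P. eventually P (finite_subsets_at_top B) \<and>
        (\<forall>F F'. P F \<and> P F' \<longrightarrow> dist (sum ?f F) (sum ?f F') < e)"
    proof (intro exI[of _ "\<lambda>F. finite F \<and> F0 \<subseteq> F \<and> F \<subseteq> B"] conjI allI impI)
      show "eventually (\<lambda>F. finite F \<and> F0 \<subseteq> F \<and> F \<subseteq> B) (finite_subsets_at_top B)"
        unfolding eventually_finite_subsets_at_top using F0 by blast
      show "dist (sum ?f F) (sum ?f F') < e"
        if "(finite F \<and> F0 \<subseteq> F \<and> F \<subseteq> B) \<and> (finite F' \<and> F0 \<subseteq> F' \<and> F' \<subseteq> B)" for F F'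
        using close[of F] close[of F'] that dist_triangle_half_l by blast
    qed
  qed
  moreover have "complete (UNIV :: 'a set)"
    by (meson Cauchy_convergent UNIV_I complete_def convergent_def)
  ultimately obtain L' where "(sum ?f \<longlongrightarrow> L') (finite_subsets_at_top B)"
    using complete_uniform[where S = UNIV] by (force simp: filterlim_def)
  then show ?thesis
    using summable_on_def has_sum_def by blast
qed

text \<open>The orthogonal residual of a vector with respect to a maximal orthonormal set vanishes,
  hence the vector is the sum of its Fourier series.\<close>

lemma orthonormal_basis_exists: "\<exists>B :: 'a::chilbert set. orthonormal_basis B"
proof -
  have "\<exists>M\<in>Collect orthonormal_set. \<forall>X\<in>Collect orthonormal_set. M \<subseteq> X \<longrightarrow> X = (M :: 'a set)"
  proof (rule subset_Zorn')
    fix C :: "'a set set"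
    assume C: "subset.chain (Collect orthonormal_set) C"
    have "orthonormal_set (\<Union>C)"
      unfolding orthonormal_set_def
    proof (intro ballI)
      fix x y
      assume "x \<in> \<Union>C" "y \<in> \<Union>C"
      then obtain S T where "S \<in> C" "T \<in> C" "x \<in> S" "y \<in> T"
        by blast
      with C obtain V where "V \<in> C" "x \<in> V" "y \<in> V"
        unfolding subset_chain_def by blast
      with C show "cinner x y = (if x = y then 1 else 0)"
        unfolding subset_chain_def orthonormal_set_def by blast
    qed
    then show "\<Union>C \<in> Collect orthonormal_set"
      by simp
  qed
  then obtain B :: "'a set" where B: "orthonormal_set B"
    and max: "\<And>X. orthonormal_set X \<Longrightarrow> B \<subseteq> X \<Longrightarrow> X = B"
    by auto
  have "y \<in> closure (span {c *\<^sub>C x |c x. x \<in> B})" (is "_ \<in> closure (span ?S)") for y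
  proof -
    obtain p where p: "((\<lambda>x. cinner x y *\<^sub>C x) has_sum p) B"
      using orthonormal_set_summable[OF B] unfolding summable_on_def by blast
    have ev: "eventually (\<lambda>F. finite F \<and> F \<subseteq> B) (finite_subsets_at_top B)"
      by (rule eventually_finite_subsets_at_top_weakI) simp
    have orth: "cinner w (y - p) = 0" if "w \<in> B" for w
    proof -
      have "((\<lambda>x. cinner w (cinner x y *\<^sub>C x)) has_sum cinner w p) B"
        by (rule has_sum_bounded_linear[OF bounded_linear_cinner p])
      moreover have "((\<lambda>x. cinner w (cinner x y *\<^sub>C x)) has_sum cinner w y) B"
      proof (rule has_sum_finite_neutralI[of "{w}"])
        show "cinner w (cinner x y *\<^sub>C x) = 0" if "x \<in> B - {w}" for x
          using that B \<open>w \<in> B\<close> by (auto simp: cinner_scaleC_right orthonormal_set_def)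
      qed (use that B in \<open>auto simp: cinner_scaleC_right orthonormal_set_def\<close>)
      ultimately show ?thesis
        using has_sum_unique by (fastforce simp: cinner_diff_right)
    qed
    have "y = p"
    proof (rule ccontr)
      assume "y \<noteq> p"
      define e where "e = (1 / norm (y - p)) *\<^sub>R (y - p)"
      have "norm e = 1"
        using \<open>y \<noteq> p\<close> by (simp add: e_def)
      then have ee: "cinner e e = 1"
        by (simp add: cinner_self)
      have we: "cinner w e = 0" if "w \<in> B" for w
        using orth[OF that] by (simp add: e_def cinner_scaleR_right)
      then have ew: "cinner e w = 0" if "w \<in> B" for w
        using that cinner_commute[of e w] by simp
      have "orthonormal_set (insert e B)"
        using B ee we ew unfolding orthonormal_set_def by (auto split: if_splits)
      then have "e \<in> B"
        using max by blast
      then show False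
        using we ee by force
    qed
    have "((\<lambda>F. \<Sum>x\<in>F. cinner x y *\<^sub>C x) \<longlongrightarrow> y) (finite_subsets_at_top B)"
      using p \<open>y = p\<close> by (simp add: has_sum_def)
    moreover have "eventually (\<lambda>F. (\<Sum>x\<in>F. cinner x y *\<^sub>C x) \<in> closure (span ?S)) (finite_subsets_at_top B)"
      using ev
    proof eventually_elim
      case (elim F)
      then have "(\<Sum>x\<in>F. cinner x y *\<^sub>C x) \<in> span ?S"
        by (intro span_sum span_base) auto
      then show ?case
        using closure_subset by blast
    qed
    ultimately show ?thesis
      by (intro Lim_in_closed_set[OF closed_closure]) auto
  qed
  then have "orthonormal_basis B"
    using B unfolding orthonormal_basis_def orthonormal_set_def total_set_def by blast
  then show ?thesis
    by blast
qed

section \<open>Expectations as vacuum matrix elements\<close>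

text \<open>\<open>S\<close> is an everywhere defined adjoint of \<open>T\<close>. Unlike
  self-adjointness this is stable under products, and it is all that the evaluation of the trace
  requires.\<close>

definition adjoint_pair :: "('a::chilbert \<Rightarrow> 'a) \<Rightarrow> ('a \<Rightarrow> 'a) \<Rightarrow> bool"
  where "adjoint_pair S T \<longleftrightarrow> (\<forall>x y. cinner x (T y) = cinner (S x) y)"

lemma adjoint_pair_compose:
  "adjoint_pair S T \<Longrightarrow> adjoint_pair S' T' \<Longrightarrow> adjoint_pair (S' \<circ> S) (T \<circ> T')"
  by (simp add: adjoint_pair_def)

lemma adjoint_pair_scaleR:
  "adjoint_pair S T \<Longrightarrow> adjoint_pair (\<lambda>\<psi>. r *\<^sub>R S \<psi>) (\<lambda>\<psi>. r *\<^sub>R T \<psi>)"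
  by (simp add: adjoint_pair_def cinner_scaleR_left cinner_scaleR_right)

lemma adjoint_pair_diff:
  "adjoint_pair S T \<Longrightarrow> adjoint_pair S' T' \<Longrightarrow>
    adjoint_pair (\<lambda>\<psi>. S \<psi> - S' \<psi>) (\<lambda>\<psi>. T \<psi> - T' \<psi>)"
  by (simp add: adjoint_pair_def cinner_diff_left cinner_diff_right)

lemma adjoint_pair_sum:
  "(\<And>i. i \<in> I \<Longrightarrow> adjoint_pair (S i) (T i)) \<Longrightarrow>
    adjoint_pair (\<lambda>\<psi>. \<Sum>i\<in>I. S i \<psi>) (\<lambda>\<psi>. \<Sum>i\<in>I. T i \<psi>)"
  by (simp add: adjoint_pair_def cinner_sum_left cinner_sum_right)

lemma adjoint_pair_selfadjoint: "bounded_selfadjoint T \<Longrightarrow> adjoint_pair T T"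
  by (simp add: adjoint_pair_def bounded_selfadjoint_def)

lemma has_sum_finite_sum:
  fixes h :: "'i \<Rightarrow> 'a \<Rightarrow> 'b::topological_comm_monoid_add"
  assumes "finite I" "\<And>i. i \<in> I \<Longrightarrow> (h i has_sum s i) A"
  shows "((\<lambda>x. \<Sum>i\<in>I. h i x) has_sum (\<Sum>i\<in>I. s i)) A"
  using assms by (induction I rule: finite_induct) (auto intro: has_sum_add)

lemma cinner_axis_tensor:
  "cinner (axis j 1 \<otimes>\<^sub>v \<phi>) \<psi> = cinner \<phi> (\<psi> $ j)" for \<psi> :: "('f::chilbert) ^ 'd"
proof -
  have "cinner ((axis j 1 :: complex ^ 'd) $ i *\<^sub>C \<phi>) (\<psi> $ i)
      = (if i = j then cinner \<phi> (\<psi> $ i) else 0)" for i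
    by (simp add: axis_def)
  then show ?thesis
    by (simp add: cinner_vec_def tensor_vec_def)
qed

lemma cinner_tensor_axis:
  "cinner \<psi> (axis j 1 \<otimes>\<^sub>v \<phi>) = cinner (\<psi> $ j) \<phi>" for \<psi> :: "('f::chilbert) ^ 'd"
  by (metis cinner_axis_tensor cinner_commute)

text \<open>The trace of (D \<otimes> |vac><vac|) T, written as a finite sum over the standard basis
  of the first factor; no basis of the Fock space enters.\<close>

definition vev ::
    "((real \<Rightarrow> complex ^ 'k) \<Rightarrow> 'f::chilbert) \<Rightarrow> complex ^ 'd ^ 'd \<Rightarrow> ('f ^ 'd \<Rightarrow> 'f ^ 'd) \<Rightarrow> complex"
  where "vev ex D T = (\<Sum>i\<in>UNIV. \<Sum>j\<in>UNIV. D $ i $ j *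
    cinner (axis j 1 \<otimes>\<^sub>v vacuum ex) (T (axis i 1 \<otimes>\<^sub>v vacuum ex)))"

text \<open>Displays the state as a finite combination of rank one operators, so that each summand
  of the trace becomes a product of two Fourier coefficients.\<close>

lemma cinner_system_state:
  fixes ex :: "(real \<Rightarrow> complex ^ 'k) \<Rightarrow> 'f::chilbert" and D :: "complex ^ 'd ^ 'd"
  shows "cinner x (system_state ex D \<psi>) = (\<Sum>i\<in>UNIV. \<Sum>j\<in>UNIV. D $ i $ j *
    (cinner x (axis i 1 \<otimes>\<^sub>v vacuum ex) * cinner (axis j 1 \<otimes>\<^sub>v vacuum ex) \<psi>))"
  unfolding cinner_axis_tensor cinner_tensor_axis
  by (simp add: cinner_vec_def system_state_def tensor_op_def cinner_sum_right cinner_scaleC_right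
      mult_ac)

text \<open>Once \<open>T\<close> is moved to the other side as \<open>S\<close>, Parseval sums each
  rank one contribution. This holds for every orthonormal basis; existence of one is what makes the
  \<open>SOME\<close> in \<open>op_trace\<close> meaningful.\<close>

lemma expect_eq_vev:
  fixes ex :: "(real \<Rightarrow> complex ^ 'k) \<Rightarrow> 'f::chilbert" and D :: "complex ^ 'd ^ 'd"
  assumes "adjoint_pair S T"
  shows "expect ex D T = vev ex D T"
proof -
  define B where "B = (SOME B :: ('f ^ 'd) set. orthonormal_basis B)"
  have B: "orthonormal_basis B"
    unfolding B_def using orthonormal_basis_exists by (rule someI_ex)
  let ?v = "\<lambda>i :: 'd. axis i 1 \<otimes>\<^sub>v vacuum ex"
  have S: "cinner x (T y) = cinner (S x) y" for x y
    using assms by (simp add: adjoint_pair_def)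
  have "((\<lambda>x. \<Sum>i\<in>UNIV. \<Sum>j\<in>UNIV. D $ i $ j * (cinner x (?v i) * cinner (S (?v j)) x)) has_sum
      (\<Sum>i\<in>UNIV. \<Sum>j\<in>UNIV. D $ i $ j * cinner (S (?v j)) (?v i))) B"
    by (intro has_sum_finite_sum has_sum_cmult_right parseval B finite)
  then have "((\<lambda>x. cinner x ((system_state ex D \<circ> T) x)) has_sum vev ex D T) B"
    by (simp add: cinner_system_state vev_def S)
  then show ?thesis
    unfolding expect_def op_trace_def B_def[symmetric] by (rule infsumI)
qed

text \<open>Conjugation exchanges the two indices, and hermiticity of \<open>D\<close> undoes the
  exchange. Consequently self-adjoint operators have real expectations, and reversing a product of
  two of them preserves the real part.\<close>

lemma vev_adjoint:
  assumes "adjoint_pair S T" "hermitian_matrix D"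
  shows "vev ex D S = cnj (vev ex D T)"
proof -
  let ?v = "\<lambda>i. axis i 1 \<otimes>\<^sub>v vacuum ex"
  have "cinner (?v j) (S (?v i)) = cnj (cinner (?v i) (T (?v j)))" for i j
    using assms(1) unfolding adjoint_pair_def by (subst cinner_commute) simp
  moreover have "D $ i $ j = cnj (D $ j $ i)" for i j
    using assms(2) unfolding hermitian_matrix_def by blast
  ultimately have "D $ i $ j * cinner (?v j) (S (?v i)) = cnj (D $ j $ i * cinner (?v i) (T (?v j)))"
    for i j
    by (metis complex_cnj_mult)
  then have "vev ex D S = (\<Sum>i\<in>UNIV. \<Sum>j\<in>UNIV. cnj (D $ j $ i * cinner (?v i) (T (?v j))))"
    unfolding vev_def by (intro sum.cong refl) simp
  also have "\<dots> = cnj (vev ex D T)"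
    unfolding vev_def cnj_sum by (rule sum.swap)
  finally show ?thesis .
qed

lemma vev_diff: "vev ex D (\<lambda>\<psi>. S \<psi> - T \<psi>) = vev ex D S - vev ex D T"
  by (simp add: vev_def cinner_diff_right right_diff_distrib sum_subtractf)

lemma vev_add: "vev ex D (\<lambda>\<psi>. S \<psi> + T \<psi>) = vev ex D S + vev ex D T"
  by (simp add: vev_def cinner_add_right distrib_left sum.distrib)

lemma vev_scaleC: "vev ex D (\<lambda>\<psi>. c *\<^sub>C T \<psi>) = c * vev ex D T"
  by (simp add: vev_def cinner_scaleC_right sum_distrib_left mult_ac)

lemma vev_scaleR: "vev ex D (\<lambda>\<psi>. r *\<^sub>R T \<psi>) = of_real r * vev ex D T"
  using vev_scaleC[of ex D "of_real r"] by (simp add: scaleC_of_real)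

lemma vev_sum: "vev ex D (\<lambda>\<psi>. \<Sum>i\<in>A. T i \<psi>) = (\<Sum>i\<in>A. vev ex D (T i))"
proof (induction A rule: infinite_finite_induct)
  case (insert x A)
  then show ?case by (simp add: vev_add)
qed (simp_all add: vev_def)

text \<open>The vacuum has squared norm exp 0 = 1, which leaves the trace of
  \<open>D\<close>.\<close>

lemma vev_id:
  fixes ex :: "(real \<Rightarrow> complex ^ 'k) \<Rightarrow> 'f::chilbert"
  assumes "symmetric_fock_space ex" "trace D = 1"
  shows "vev ex D (\<lambda>\<psi>. \<psi>) = 1"
proof -
  have "(\<lambda>s. 0 :: complex ^ 'k) \<in> L2_half_line"
    by (simp add: L2_half_line_def)
  then have "cinner (vacuum ex) (vacuum ex) = 1"
    using assms(1) by (simp add: symmetric_fock_space_def vacuum_def L2_inner_def)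
  then have "D $ i $ j * cinner (axis j 1 \<otimes>\<^sub>v vacuum ex) (axis i 1 \<otimes>\<^sub>v vacuum ex)
      = (if j = i then D $ i $ i else 0)" for i j
    unfolding cinner_axis_tensor by (simp add: tensor_vec_def axis_def)
  then show ?thesis
    using assms(2) by (simp add: vev_def trace_def)
qed

section \<open>Vacuum matrix elements of the system variables\<close>

lemma tensor_vec_diff_right: "u \<otimes>\<^sub>v (\<phi> - \<eta>) = u \<otimes>\<^sub>v \<phi> - u \<otimes>\<^sub>v \<eta>"
  by (simp add: tensor_vec_def vec_eq_iff scaleC_diff_right)

lemma tensor_vec_scaleC_right: "u \<otimes>\<^sub>v (c *\<^sub>C \<phi>) = c *\<^sub>C (u \<otimes>\<^sub>v \<phi>)"
  by (simp add: tensor_vec_def scaleC_vec_def vec_eq_iff scaleC_scaleC mult.commute)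

lemma bounded_linear_tensor_vec: "bounded_linear (\<lambda>\<phi>. u \<otimes>\<^sub>v \<phi>)"
  for u :: "complex ^ 'd"
proof (rule bounded_linear_intro[where K = "\<Sum>i\<in>UNIV. norm (u $ i)"])
  show "u \<otimes>\<^sub>v (\<phi> + \<eta>) = u \<otimes>\<^sub>v \<phi> + u \<otimes>\<^sub>v \<eta>" for \<phi> \<eta> :: 'a
    by (simp add: tensor_vec_def vec_eq_iff scaleC_add_right)
  show "u \<otimes>\<^sub>v (r *\<^sub>R \<phi>) = r *\<^sub>R (u \<otimes>\<^sub>v \<phi>)" for r and \<phi> :: 'a
    using tensor_vec_scaleC_right[of u "of_real r"] by (simp add: scaleC_of_real)
  show "norm (u \<otimes>\<^sub>v \<phi>) \<le> norm \<phi> * (\<Sum>i\<in>UNIV. norm (u $ i))" for \<phi> :: 'a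
  proof -
    have "norm (u \<otimes>\<^sub>v \<phi>) \<le> (\<Sum>i\<in>UNIV. norm ((u \<otimes>\<^sub>v \<phi>) $ i))"
      unfolding norm_vec_def by (rule L2_set_le_sum) simp
    then show ?thesis
      by (simp add: tensor_vec_def norm_scaleC sum_distrib_left mult.commute)
  qed
qed

text \<open>The test functions generating the Wiener process, and their restrictions to times before
  and after \<open>s\<close>, are of this form; adaptedness and the Fock inner product are specified
  only on \<open>L2_half_line\<close>.\<close>

lemma indicator_in_L2_half_line:
  assumes S: "S \<in> sets lebesgue" "bounded S"
  shows "(\<lambda>r. indicator S r *\<^sub>R x) \<in> L2_half_line"
proof -
  have "(\<lambda>r. indicator S r *\<^sub>R x) \<in> borel_measurable (lebesgue_on {0..})"
    by (rule measurable_restrict_space1)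
      (use S in \<open>intro borel_measurable_scaleR borel_measurable_indicator; simp\<close>)
  moreover have "integrable (lebesgue_on {0..}) (\<lambda>r. (norm (indicator S r *\<^sub>R x))\<^sup>2)"
  proof -
    have "S \<inter> {0..} \<in> lmeasurable"
      using S by (intro bounded_set_imp_lmeasurable) (auto intro: bounded_subset)
    then have "integrable lebesgue (\<lambda>r. indicator (S \<inter> {0..}) r * (norm x)\<^sup>2)"
      by (intro integrable_mult_left integrable_real_indicator) (auto simp: fmeasurable_def)
    moreover have "indicator (S \<inter> {0..}) r * (norm x)\<^sup>2
        = indicator {0..} r *\<^sub>R (norm (indicator S r *\<^sub>R x))\<^sup>2" for r :: real
      by (simp add: indicator_def)
    ultimately show ?thesis
      by (simp add: integrable_restrict_space)
  qed
  ultimately show ?thesis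
    by (simp add: L2_half_line_def)
qed

lemma zero_in_L2_half_line: "(\<lambda>r. 0) \<in> L2_half_line"
  by (simp add: L2_half_line_def)

lemma cinner_vacuum_exponential:
  assumes "symmetric_fock_space ex" "h \<in> L2_half_line"
  shows "cinner (vacuum ex) (ex h) = 1"
  using assms
  by (simp add: symmetric_fock_space_def vacuum_def L2_inner_def zero_in_L2_half_line)

text \<open>Adaptedness replaces the coherent vector by its restriction to \<open>[0, s]\<close>, on which the
  indicators of \<open>[0, s]\<close> and \<open>[0, s']\<close> agree.\<close>

lemma adapted_vacuum_indicator:
  fixes ex :: "(real \<Rightarrow> complex ^ 'k) \<Rightarrow> 'f::chilbert"
  assumes fock: "symmetric_fock_space ex" and adapted: "adapted_at ex s T" and "s \<le> s'"
  shows "cinner (a \<otimes>\<^sub>v vacuum ex) (T (u \<otimes>\<^sub>v ex (\<lambda>r. \<epsilon> *\<^sub>R channel_indicator j s' r))) =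
    cinner (a \<otimes>\<^sub>v vacuum ex) (T (u \<otimes>\<^sub>v ex (\<lambda>r. \<epsilon> *\<^sub>R channel_indicator j s r)))"
proof -
  \<comment> \<open>The right-hand side does not involve \<open>q\<close>; the claim is used for
    \<open>q = s'\<close> and for \<open>q = s\<close>.\<close>
  have *: "cinner (a \<otimes>\<^sub>v vacuum ex) (T (u \<otimes>\<^sub>v ex (\<lambda>r. \<epsilon> *\<^sub>R channel_indicator j q r))) =
    cinner (a \<otimes>\<^sub>v vacuum ex) (T (u \<otimes>\<^sub>v ex (\<lambda>r. indicator {0..s} r *\<^sub>R \<epsilon> *\<^sub>R axis j 1)))"
    if "s \<le> q" for q
  proof -
    let ?h = "\<lambda>r. \<epsilon> *\<^sub>R channel_indicator j q r"
    have "?h = (\<lambda>r. indicator {0..q} r *\<^sub>R \<epsilon> *\<^sub>R axis j 1)"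
      by (simp add: channel_indicator_def mult.commute)
    then have h: "?h \<in> L2_half_line"
      by (metis indicator_in_L2_half_line bounded_closed_interval lmeasurable_interval(1) fmeasurableD)
    have "after s ?h = (\<lambda>r. indicator ({s<..} \<inter> {0..q}) r *\<^sub>R \<epsilon> *\<^sub>R axis j 1)"
      by (auto simp: after_def channel_indicator_def indicator_def fun_eq_iff)
    moreover have "(\<lambda>r. indicator ({s<..} \<inter> {0..q}) r *\<^sub>R \<epsilon> *\<^sub>R (axis j 1 :: complex ^ 'k)) \<in> L2_half_line"
      by (intro indicator_in_L2_half_line) (auto intro: bounded_subset[OF bounded_closed_interval])
    ultimately have after: "cinner (vacuum ex) (ex (after s ?h)) = 1"
      by (simp add: cinner_vacuum_exponential[OF fock])
    have before: "before s ?h = (\<lambda>r. indicator {0..s} r *\<^sub>R \<epsilon> *\<^sub>R axis j 1)"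
      using that by (auto simp: before_def channel_indicator_def indicator_def fun_eq_iff)
    have zero: "before s (\<lambda>r. 0 :: complex ^ 'k) = (\<lambda>r. 0)" "after s (\<lambda>r. 0 :: complex ^ 'k) = (\<lambda>r. 0)"
      by (simp_all add: before_def after_def)
    \<comment> \<open>The vacuum is the exponential vector of 0, and 0 restricts to 0 on either side
      of \<open>s\<close>. The factor for later times is thus a vacuum matrix element, equal to
      1.\<close>
    have "cinner (a \<otimes>\<^sub>v ex (\<lambda>r. 0)) (T (u \<otimes>\<^sub>v ex ?h)) =
       cinner (a \<otimes>\<^sub>v ex (before s (\<lambda>r. 0))) (T (u \<otimes>\<^sub>v ex (before s ?h)))
         * cinner (ex (after s (\<lambda>r. 0))) (ex (after s ?h))"
      using adapted h zero_in_L2_half_line unfolding adapted_at_def by blast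
    then show ?thesis
      using after unfolding zero before vacuum_def by simp
  qed
  from *[of s'] *[of s] assms(3) show ?thesis
    by simp
qed

section \<open>The martingale property in the vacuum and the vanishing of Ito integrals\<close>

text \<open>On the vacuum, \<open>W s k\<close> is up to the factor 1 or \<i> the derivative at 0 of
  a curve of exponential vectors. The functional \<open>H\<close> takes the same values along the
  curves for \<open>s\<close> and \<open>s'\<close>, hence also on their derivatives.\<close>

lemma vacuum_wiener_martingale:
  fixes ex :: "(real \<Rightarrow> complex ^ 'k) \<Rightarrow> 'f::chilbert" and T :: "'f ^ 'd \<Rightarrow> 'f ^ 'd"
  assumes fock: "symmetric_fock_space ex" and wiener: "quantum_wiener_process ex W"
    and adapted: "adapted_at ex s T" and T: "complex_linear_op T" "bounded_linear T"
    and s: "0 \<le> s" "s \<le> s'"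
  shows "cinner (a \<otimes>\<^sub>v vacuum ex) (T (u \<otimes>\<^sub>v W s' k (vacuum ex))) =
    cinner (a \<otimes>\<^sub>v vacuum ex) (T (u \<otimes>\<^sub>v W s k (vacuum ex)))"
proof -
  define H where "H \<phi> = cinner (a \<otimes>\<^sub>v vacuum ex) (T (u \<otimes>\<^sub>v \<phi>))" for \<phi>
  have H: "bounded_linear H"
    unfolding H_def
    by (rule bounded_linear_compose[OF bounded_linear_cinner
          bounded_linear_compose[OF T(2) bounded_linear_tensor_vec]])
  have H_scaleC: "H (c *\<^sub>C \<phi>) = c * H \<phi>" for c \<phi>
    using T(1) by (simp add: H_def tensor_vec_scaleC_right complex_linear_op_def cinner_scaleC_right)
  obtain j q where k: "k = (j, q)"
    by (cases k)
  define h where "h q \<epsilon> = ex (\<lambda>r. \<epsilon> *\<^sub>R channel_indicator j q r)" for q \<epsilon>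
  \<comment> \<open>For the test function 0 the annihilation part vanishes; the two quadratures then
    give \<open>cre\<close> and \<i> times \<open>cre\<close>.\<close>
  have W: "\<exists>cre. (h p has_vector_derivative cre) (at 0) \<and>
      W p k (vacuum ex) = (if q then \<i> else 1) *\<^sub>C cre" if "0 \<le> p" for p
    using wiener[unfolded quantum_wiener_process_def, rule_format, OF that zero_in_L2_half_line, of j]
    by (auto simp: k h_def[abs_def] vacuum_def)
  obtain cre where cre: "(h s has_vector_derivative cre) (at 0)"
    "W s k (vacuum ex) = (if q then \<i> else 1) *\<^sub>C cre"
    using W s by blast
  obtain cre' where cre': "(h s' has_vector_derivative cre') (at 0)"
    "W s' k (vacuum ex) = (if q then \<i> else 1) *\<^sub>C cre'"
    using W s by (meson order_trans)
  have "((\<lambda>\<epsilon>. H (h s \<epsilon>)) has_vector_derivative H cre) (at 0)"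
    "((\<lambda>\<epsilon>. H (h s' \<epsilon>)) has_vector_derivative H cre') (at 0)"
    using bounded_linear.has_vector_derivative[OF H] cre(1) cre'(1) by blast+
  moreover have "H (h s' \<epsilon>) = H (h s \<epsilon>)" for \<epsilon>
    unfolding H_def h_def by (rule adapted_vacuum_indicator[OF fock adapted s(2)])
  ultimately have "H cre' = H cre"
    using vector_derivative_unique_at by force
  then show ?thesis
    unfolding H_def[symmetric] cre(2) cre'(2) H_scaleC by simp
qed

text \<open>In a left-endpoint sum every integrand is adapted to the time at which its increment
  starts, so each term has zero vacuum matrix element; continuity of the inner product passes this
  to the limit.\<close>

lemma vacuum_ito_integral:
  fixes ex :: "(real \<Rightarrow> complex ^ 'k::finite) \<Rightarrow> 'f::chilbert"
    and X :: "real \<Rightarrow> 'n::finite \<Rightarrow> 'f ^ 'd \<Rightarrow> 'f ^ 'd"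
  assumes fock: "symmetric_fock_space ex" and wiener: "quantum_wiener_process ex W"
    and adapted: "\<And>s l. 0 \<le> s \<Longrightarrow> adapted_at ex s (X s l)"
    and X: "\<And>s l. 0 \<le> s \<Longrightarrow> bounded_selfadjoint (X s l)"
    and "0 \<le> t"
    and I: "has_ito_integral ex W k (\<lambda>s. dispersion \<beta> M (X s) j k) t u (\<lambda>s. 0) I"
  shows "cinner (a \<otimes>\<^sub>v vacuum ex) I = 0"
proof -
  let ?w = "a \<otimes>\<^sub>v vacuum ex"
  have zero: "cinner ?w (dispersion \<beta> M (X s) j k
      (u \<otimes>\<^sub>v (W s' k (vacuum ex) - W s k (vacuum ex)))) = 0" if s: "0 \<le> s" "s \<le> s'" for s s'
  proof -
    have "cinner ?w (X s l (u \<otimes>\<^sub>v (W s' k (vacuum ex) - W s k (vacuum ex)))) = 0" for l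
    proof -
      have T: "complex_linear_op (X s l)" "bounded_linear (X s l)"
        using X[OF s(1)] by (auto simp: bounded_selfadjoint_def)
      show ?thesis
        using vacuum_wiener_martingale[OF fock wiener adapted[OF s(1)] T s]
        by (simp add: tensor_vec_diff_right bounded_linear.linear[OF T(2)] linear_diff cinner_diff_right)
    qed
    then show ?thesis
      by (simp add: dispersion_def cinner_sum_right cinner_scaleR_right)
  qed
  \<comment> \<open>For \<open>N = 0\<close> both endpoints are 0, as division by 0 yields 0, so
    their order holds for every \<open>N\<close>.\<close>
  have "cinner ?w (dispersion \<beta> M (X (t * real i / real N)) j k (u \<otimes>\<^sub>v
      (W (t * real (Suc i) / real N) k (vacuum ex) - W (t * real i / real N) k (vacuum ex)))) = 0"
    for i N
    by (rule zero) (use \<open>0 \<le> t\<close> in \<open>auto intro!: divide_right_mono mult_left_mono\<close>)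
  moreover have "(\<lambda>N. cinner ?w (\<Sum>i<N. dispersion \<beta> M (X (t * real i / real N)) j k (u \<otimes>\<^sub>v
      (W (t * real (Suc i) / real N) k (vacuum ex) - W (t * real i / real N) k (vacuum ex)))))
      \<longlonglongrightarrow> cinner ?w I"
    using I unfolding has_ito_integral_def vacuum_def
    by (rule bounded_linear.tendsto[OF bounded_linear_cinner])
  ultimately have "(\<lambda>N. 0) \<longlonglongrightarrow> cinner ?w I"
    by (simp only: cinner_sum_right) simp
  then show ?thesis
    by (simp add: LIMSEQ_const_iff)
qed

text \<open>Pairing the integral equation at the test function 0 with a vacuum vector removes the
  noise and leaves a linear integral equation for scalar functions, to which the fundamental theorem
  of calculus applies.\<close>

lemma vacuum_element_has_derivative:
  fixes ex :: "(real \<Rightarrow> complex ^ 'k::finite) \<Rightarrow> 'f::chilbert"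
    and X :: "real \<Rightarrow> 'n::finite \<Rightarrow> 'f ^ 'd \<Rightarrow> 'f ^ 'd" and a u :: "complex ^ 'd"
  assumes fock: "symmetric_fock_space ex" and wiener: "quantum_wiener_process ex W"
    and X: "\<And>s l. 0 \<le> s \<Longrightarrow> bounded_selfadjoint (X s l)"
    and qsde: "solves_qsde ex W A b \<beta> M X"
    and A: "continuous_on {0..} A"
    and "0 \<le> t"
  defines "m \<equiv> \<lambda>j s. cinner (a \<otimes>\<^sub>v vacuum ex) (X s j (u \<otimes>\<^sub>v vacuum ex))"
  shows "(m j has_vector_derivative (\<Sum>l\<in>UNIV. of_real (A t $ j $ l) * m l t)
    + of_real (b $ j) * cinner (a \<otimes>\<^sub>v vacuum ex) (u \<otimes>\<^sub>v vacuum ex)) (at t within {0..})"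
proof -
  let ?w = "a \<otimes>\<^sub>v vacuum ex"
  define h where "h j s = (\<Sum>l\<in>UNIV. of_real (A s $ j $ l) * m l s)
    + of_real (b $ j) * cinner ?w (u \<otimes>\<^sub>v vacuum ex)" for j s
  have int: "(h j has_integral (m j s - m j 0)) {0..s}" if s: "0 \<le> s" for j s
  proof -
    let ?f = "\<lambda>s. (\<Sum>l\<in>UNIV. (A s $ j $ l) *\<^sub>R X s l (u \<otimes>\<^sub>v ex (\<lambda>s. 0))) + (b $ j) *\<^sub>R (u \<otimes>\<^sub>v ex (\<lambda>s. 0))"
    obtain D I where D: "(?f has_integral D) {0..s}"
      and I: "\<forall>k. has_ito_integral ex W k (\<lambda>s. dispersion \<beta> M (X s) j k) s u (\<lambda>s. 0) (I k)"
      and "X s j (u \<otimes>\<^sub>v ex (\<lambda>s. 0)) = X 0 j (u \<otimes>\<^sub>v ex (\<lambda>s. 0)) + D + (\<Sum>k\<in>UNIV. I k)"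
      using conjunct2[OF qsde[unfolded solves_qsde_def], rule_format, OF s zero_in_L2_half_line, of j u]
      by (elim exE conjE)
    then have eq: "X s j (u \<otimes>\<^sub>v vacuum ex) = X 0 j (u \<otimes>\<^sub>v vacuum ex) + D + (\<Sum>k\<in>UNIV. I k)"
      by (simp add: vacuum_def)
    have "cinner ?w (I k) = 0" for k
      using vacuum_ito_integral[OF fock wiener _ X s I[rule_format]] qsde unfolding solves_qsde_def by blast
    then have "m j s - m j 0 = cinner ?w D"
      by (simp add: m_def eq cinner_add_right cinner_sum_right)
    moreover have "((cinner ?w \<circ> ?f) has_integral cinner ?w D) {0..s}"
      by (rule has_integral_linear[OF D bounded_linear_cinner])
    moreover have "cinner ?w \<circ> ?f = h j"
      by (simp add: fun_eq_iff h_def m_def vacuum_def cinner_add_right cinner_sum_right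
          cinner_scaleR_right)
    ultimately show ?thesis
      by simp
  qed
  \<comment> \<open>The extra unit keeps \<open>t\<close> away from the right end; at
    \<open>t = 0\<close> the derivative remains one-sided.\<close>
  let ?J = "{0..t + 1}"
  have m_eq: "m j s = m j 0 + integral {0..s} (h j)" if "s \<in> ?J" for j s
    using integral_unique[OF int, of s] that by simp
  \<comment> \<open>Continuity of \<open>m\<close> is drawn from the integral equation itself: an
    indefinite integral is continuous. With \<open>A\<close> continuous, so is the integrand
    \<open>h\<close>.\<close>
  have cont_m: "continuous_on ?J (m j)" for j
  proof (rule continuous_on_eq)
    show "continuous_on ?J (\<lambda>s. m j 0 + integral {0..s} (h j))"
      by (intro continuous_on_add continuous_on_const indefinite_integral_continuous_1
          has_integral_integrable[OF int]) (use \<open>0 \<le> t\<close> in simp)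
  qed (rule m_eq[symmetric])
  have "continuous_on ?J A"
    using A by (rule continuous_on_subset) auto
  then have "continuous_on ?J (h j)"
    unfolding h_def[abs_def] by (intro continuous_intros cont_m)
  then have "((\<lambda>s. integral {0..s} (h j)) has_vector_derivative h j t) (at t within ?J)"
    using \<open>0 \<le> t\<close> by (intro integral_has_vector_derivative) auto
  then have "((\<lambda>s. m j 0 + integral {0..s} (h j)) has_vector_derivative h j t) (at t within ?J)"
    by (auto intro!: derivative_eq_intros)
  then have "(m j has_vector_derivative h j t) (at t within ?J)"
    by (rule has_vector_derivative_transform[OF _ m_eq, rotated 2]) (use \<open>0 \<le> t\<close> in simp)
  moreover have "at t within ?J = at t within {0..}"
    by (rule at_within_nhd[of _ "{..<t + 1}"]) auto
  ultimately show ?thesis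
    by (simp add: h_def)
qed

section \<open>Mean values and two-point correlations\<close>

text \<open>Serves both for the means, with \<open>Y\<close> the identity, and for the correlations,
  with \<open>Y\<close> an initial variable. The assumption on \<open>Y\<close> keeps the argument
  of \<open>X s j\<close> of the form \<open>w i \<otimes>\<^sub>v vacuum ex\<close>, where the
  scalar equation is available.\<close>

lemma vev_has_derivative:
  fixes ex :: "(real \<Rightarrow> complex ^ 'k::finite) \<Rightarrow> 'f::chilbert"
    and X :: "real \<Rightarrow> 'n::finite \<Rightarrow> 'f ^ 'd \<Rightarrow> 'f ^ 'd"
  assumes fock: "symmetric_fock_space ex" and wiener: "quantum_wiener_process ex W"
    and X: "\<And>s l. 0 \<le> s \<Longrightarrow> bounded_selfadjoint (X s l)"
    and qsde: "solves_qsde ex W A b \<beta> M X"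
    and A: "continuous_on {0..} A"
    and t: "0 \<le> t"
    and Y: "\<And>i. Y (axis i 1 \<otimes>\<^sub>v vacuum ex) = w i \<otimes>\<^sub>v vacuum ex"
  shows "((\<lambda>s. Re (vev ex D (\<lambda>\<psi>. X s j (Y \<psi>)))) has_real_derivative
    (\<Sum>l\<in>UNIV. A t $ j $ l * Re (vev ex D (\<lambda>\<psi>. X t l (Y \<psi>)))) + b $ j * Re (vev ex D Y))
    (at t within {0..})"
proof -
  let ?v = "\<lambda>i :: 'd. axis i 1 \<otimes>\<^sub>v vacuum ex"
  have "((\<lambda>s. vev ex D (\<lambda>\<psi>. X s j (Y \<psi>))) has_vector_derivative
    (\<Sum>i\<in>UNIV. \<Sum>q\<in>UNIV. D $ i $ q *
      ((\<Sum>l\<in>UNIV. of_real (A t $ j $ l) * cinner (?v q) (X t l (w i \<otimes>\<^sub>v vacuum ex)))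
        + of_real (b $ j) * cinner (?v q) (w i \<otimes>\<^sub>v vacuum ex)))) (at t within {0..})"
    unfolding vev_def Y
    by (intro has_vector_derivative_sum has_vector_derivative_mult_right
        vacuum_element_has_derivative[OF fock wiener X qsde A t])
  moreover have "(\<Sum>i\<in>UNIV. \<Sum>q\<in>UNIV. D $ i $ q *
      ((\<Sum>l\<in>UNIV. of_real (A t $ j $ l) * cinner (?v q) (X t l (w i \<otimes>\<^sub>v vacuum ex)))
        + of_real (b $ j) * cinner (?v q) (w i \<otimes>\<^sub>v vacuum ex))) =
    vev ex D (\<lambda>\<psi>. (\<Sum>l\<in>UNIV. (A t $ j $ l) *\<^sub>R X t l (Y \<psi>)) + (b $ j) *\<^sub>R Y \<psi>)"
    by (simp add: vev_def Y cinner_add_right cinner_sum_right cinner_scaleR_right)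
  ultimately have "((\<lambda>s. vev ex D (\<lambda>\<psi>. X s j (Y \<psi>))) has_vector_derivative
    (\<Sum>l\<in>UNIV. of_real (A t $ j $ l) * vev ex D (\<lambda>\<psi>. X t l (Y \<psi>))) + of_real (b $ j) * vev ex D Y)
    (at t within {0..})"
    by (simp add: vev_add vev_sum vev_scaleR)
  from bounded_linear.has_vector_derivative[OF bounded_linear_Re this] show ?thesis
    by (simp add: has_real_derivative_iff_has_vector_derivative)
qed

lemma mean_eq_vev:
  assumes "bounded_selfadjoint (X t j)"
  shows "mean ex D X t $ j = Re (vev ex D (X t j))"
  by (simp add: mean_def expect_eq_vev[OF adjoint_pair_selfadjoint[OF assms]])

lemma expect_compose:
  assumes "adjoint_pair S T" "adjoint_pair S' T'"
  shows "expect ex D (T \<circ> T') = vev ex D (\<lambda>\<psi>. T (T' \<psi>))"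
  using expect_eq_vev[OF adjoint_pair_compose[OF assms], of ex D] by (simp add: o_def)

lemma P_mat_eq_vev:
  assumes "\<And>j. bounded_selfadjoint (X 0 j)"
  shows "P_mat ex D X $ j $ k = Re (vev ex D (\<lambda>\<psi>. X 0 j (X 0 k \<psi>)))"
  by (simp add: P_mat_def
      expect_compose[OF adjoint_pair_selfadjoint[OF assms] adjoint_pair_selfadjoint[OF assms]])

lemma adjoint_pair_increment:
  assumes "bounded_selfadjoint (X t j)" "bounded_selfadjoint (X 0 j)"
  shows "adjoint_pair (increment X t j) (increment X t j)"
  unfolding increment_def by (intro adjoint_pair_diff adjoint_pair_selfadjoint assms)

text \<open>\<open>P_mat\<close> cancels the initial product subtracted in the increment, leaving
  the correlation of \<open>X t\<close> with \<open>X 0\<close>.\<close>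

lemma P_plus_Q_eq_vev:
  assumes X: "\<And>s j. 0 \<le> s \<Longrightarrow> bounded_selfadjoint (X s j)" and "0 \<le> t"
  shows "(P_mat ex D X + Q_mat ex D X t) $ j $ k = Re (vev ex D (\<lambda>\<psi>. X t j (X 0 k \<psi>)))"
proof -
  have "expect ex D (increment X t j \<circ> X 0 k) = vev ex D (\<lambda>\<psi>. increment X t j (X 0 k \<psi>))"
    by (rule expect_compose[OF adjoint_pair_increment adjoint_pair_selfadjoint])
      (simp_all add: X \<open>0 \<le> t\<close>)
  then show ?thesis
    by (simp add: Q_mat_def P_mat_eq_vev[OF X] increment_def o_def vev_diff)
qed

lemma selfadjoint_diff: "bounded_selfadjoint T \<Longrightarrow> T (x - y) = T x - T y"
  by (metis bounded_linear.linear bounded_selfadjoint_def linear_diff)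

lemma selfadjoint_sum_scaleR:
  "bounded_selfadjoint T \<Longrightarrow> T (\<Sum>i\<in>I. r i *\<^sub>R x i) = (\<Sum>i\<in>I. r i *\<^sub>R T (x i))"
  by (simp add: bounded_selfadjoint_def bounded_linear.linear linear_sum linear_scale)

lemma vev_selfadjoint_real:
  assumes "bounded_selfadjoint T" "hermitian_matrix D"
  shows "vev ex D T = of_real (Re (vev ex D T))"
  using vev_adjoint[OF adjoint_pair_selfadjoint[OF assms(1)] assms(2), of ex]
  by (metis Reals_cnj_iff of_real_Re)

text \<open>Expand the product of two increments into four terms. The algebraic relations make the
  term quadratic in \<open>X t\<close> affine in the mean, the two mixed terms give the correlation
  matrix and its transpose, and the initial term is \<open>P_mat\<close>.\<close>

lemma deviation_eq:
  fixes ex :: "(real \<Rightarrow> complex ^ 'k::finite) \<Rightarrow> 'f::chilbert"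
    and X :: "real \<Rightarrow> 'n::finite \<Rightarrow> 'f ^ 'd \<Rightarrow> 'f ^ 'd" and F :: "real ^ 'n ^ 'v"
  assumes fock: "symmetric_fock_space ex" and D: "hermitian_matrix D" "trace D = 1"
    and X: "\<And>s l. 0 \<le> s \<Longrightarrow> bounded_selfadjoint (X s l)"
    and alg: "algebraic_relations \<alpha> \<beta> (X t)"
    and t: "0 \<le> t"
  defines "S \<equiv> transpose F ** F"
  shows "deviation ex D F X t = inner S (P_mat ex D X + \<alpha>)
    + (inner (S \<star> Re_array \<beta>) (mean ex D X t) - 2 * inner S (P_mat ex D X + Q_mat ex D X t))"
proof -
  let ?v = "\<lambda>T. Re (vev ex D T)"
  have X0: "bounded_selfadjoint (X 0 j)" for j
    by (simp add: X)
  define e where "e = P_mat ex D X + Q_mat ex D X t"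
  have e: "e $ j $ k = ?v (\<lambda>\<psi>. X t j (X 0 k \<psi>))" for j k
    unfolding e_def by (rule P_plus_Q_eq_vev[OF X t])
  \<comment> \<open>Reversing the product conjugates its expectation, which the real part does not
    see.\<close>
  have e': "?v (\<lambda>\<psi>. X 0 k (X t j \<psi>)) = e $ j $ k" for j k
  proof -
    have "adjoint_pair (X 0 k \<circ> X t j) (X t j \<circ> X 0 k)"
      by (intro adjoint_pair_compose adjoint_pair_selfadjoint X t order_refl)
    from vev_adjoint[OF this D(1), of ex] show ?thesis
      by (simp add: e o_def)
  qed
  \<comment> \<open>The means are real, so the real part retains only the real part of
    \<open>\<beta>\<close>.\<close>
  have XX: "?v (\<lambda>\<psi>. X t j (X t k \<psi>)) =
      \<alpha> $ j $ k + (\<Sum>l\<in>UNIV. Re_array \<beta> $ l $ j $ k * mean ex D X t $ l)" for j k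
  proof -
    have "vev ex D (\<lambda>\<psi>. X t j (X t k \<psi>)) =
        of_real (\<alpha> $ j $ k) + (\<Sum>l\<in>UNIV. \<beta> $ l $ j $ k * vev ex D (X t l))"
      using alg by (simp add: algebraic_relations_def vev_add vev_sum vev_scaleR vev_scaleC
          vev_id[OF fock D(2)])
    moreover have "vev ex D (X t l) = of_real (mean ex D X t $ l)" for l
      using vev_selfadjoint_real[OF X[OF t] D(1)] by (simp add: mean_eq_vev[where X = X, OF X[OF t]])
    ultimately show ?thesis
      by (simp add: Re_array_def)
  qed
  \<comment> \<open>The product of the increments of components \<open>j\<close> and
    \<open>k\<close>, multiplied out.\<close>
  define G where "G j k = (\<lambda>\<psi>. X t j (X t k \<psi>) - X t j (X 0 k \<psi>) - (X 0 j (X t k \<psi>) - X 0 j (X 0 k \<psi>)))"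
    for j k
  have vG: "?v (G j k) = P_mat ex D X $ j $ k + \<alpha> $ j $ k
      + (\<Sum>l\<in>UNIV. Re_array \<beta> $ l $ j $ k * mean ex D X t $ l) - e $ j $ k - e $ k $ j" for j k
    by (simp add: G_def vev_diff XX e[symmetric] e' P_mat_eq_vev[where X = X, OF X0])
  have "adjoint_pair (\<lambda>\<psi>. \<Sum>a\<in>UNIV. (output_dev F X t a \<circ> output_dev F X t a) \<psi>)
      (\<lambda>\<psi>. \<Sum>a\<in>UNIV. (output_dev F X t a \<circ> output_dev F X t a) \<psi>)"
    unfolding output_dev_def
    by (intro adjoint_pair_sum adjoint_pair_compose adjoint_pair_scaleR adjoint_pair_increment
        X t order_refl)
  from expect_eq_vev[OF this, of ex D]
  have "deviation ex D F X t = ?v (\<lambda>\<psi>. \<Sum>a\<in>UNIV. output_dev F X t a (output_dev F X t a \<psi>))"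
    by (simp add: deviation_def)
  also have "(\<lambda>\<psi>. \<Sum>a\<in>UNIV. output_dev F X t a (output_dev F X t a \<psi>)) =
      (\<lambda>\<psi>. \<Sum>a\<in>UNIV. \<Sum>j\<in>UNIV. F $ a $ j *\<^sub>R (\<Sum>k\<in>UNIV. F $ a $ k *\<^sub>R G j k \<psi>))"
    by (simp add: output_dev_def increment_def G_def selfadjoint_sum_scaleR[OF X[OF t]]
        selfadjoint_sum_scaleR[OF X0] selfadjoint_diff[OF X[OF t]] selfadjoint_diff[OF X0]
        sum_subtractf[symmetric] scaleR_diff_right[symmetric])
  also have "?v \<dots> = (\<Sum>a\<in>UNIV. \<Sum>j\<in>UNIV. \<Sum>k\<in>UNIV. F $ a $ j * F $ a $ k * ?v (G j k))"
    by (simp add: vev_sum vev_scaleR sum_distrib_left mult.assoc)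
  also have "\<dots> = (\<Sum>j\<in>UNIV. \<Sum>k\<in>UNIV. \<Sum>a\<in>UNIV. F $ a $ j * F $ a $ k * ?v (G j k))"
    by (subst sum.swap) (intro sum.cong refl sum.swap)
  also have "\<dots> = (\<Sum>j\<in>UNIV. \<Sum>k\<in>UNIV. S $ j $ k * ?v (G j k))"
    by (simp add: S_def matrix_matrix_mult_def transpose_def sum_distrib_right)
  also have "\<dots> = inner S (P_mat ex D X + \<alpha>)
      + (\<Sum>j\<in>UNIV. \<Sum>k\<in>UNIV. \<Sum>l\<in>UNIV. S $ j $ k * (Re_array \<beta> $ l $ j $ k * mean ex D X t $ l))
      - inner S e - (\<Sum>j\<in>UNIV. \<Sum>k\<in>UNIV. S $ j $ k * e $ k $ j)"
    by (simp add: vG inner_vec_def sum.distrib sum_subtractf distrib_left right_diff_distrib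
        sum_distrib_left)
  \<comment> \<open>\<open>S\<close> is symmetric, so it pairs equally with \<open>e\<close> and its
    transpose; this is the origin of the factor 2.\<close>
  also have "(\<Sum>j\<in>UNIV. \<Sum>k\<in>UNIV. S $ j $ k * e $ k $ j) = inner S e"
  proof -
    have "S $ j $ k = S $ k $ j" for j k
      by (simp add: S_def matrix_matrix_mult_def transpose_def mult.commute)
    then have "(\<Sum>j\<in>UNIV. \<Sum>k\<in>UNIV. S $ j $ k * e $ k $ j)
        = (\<Sum>j\<in>UNIV. \<Sum>k\<in>UNIV. S $ k $ j * e $ k $ j)"
      by (intro sum.cong refl arg_cong2[where f = "(*)"])
    also have "\<dots> = inner S e"
      unfolding inner_vec_def inner_real_def by (rule sum.swap)
    finally show ?thesis .
  qed
  also have "(\<Sum>j\<in>UNIV. \<Sum>k\<in>UNIV. \<Sum>l\<in>UNIV. S $ j $ k * (Re_array \<beta> $ l $ j $ k * mean ex D X t $ l))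
      = (\<Sum>j\<in>UNIV. \<Sum>l\<in>UNIV. \<Sum>k\<in>UNIV. S $ j $ k * (Re_array \<beta> $ l $ j $ k * mean ex D X t $ l))"
    by (rule sum.cong[OF refl], rule sum.swap)
  also have "\<dots> = (\<Sum>l\<in>UNIV. \<Sum>j\<in>UNIV. \<Sum>k\<in>UNIV. S $ j $ k * (Re_array \<beta> $ l $ j $ k * mean ex D X t $ l))"
    by (rule sum.swap)
  also have "\<dots> = inner (S \<star> Re_array \<beta>) (mean ex D X t)"
    by (simp add: inner_vec_def star_def sum_distrib_right mult.assoc)
  finally show ?thesis
    by (simp add: e_def)
qed

section \<open>The rate of the deviation\<close>

lemma inner_join_column:
  fixes u v :: "real ^ 'n"
  shows "inner (join_column u S) (join_column v T) = inner u v + inner S T"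
proof -
  have "sum h (UNIV :: 'n option set) = h None + (\<Sum>k\<in>UNIV. h (Some k))" for h :: "'n option \<Rightarrow> real"
    by (simp add: UNIV_option_conv sum.reindex)
  then show ?thesis
    by (simp add: inner_vec_def join_column_def sum.distrib)
qed

lemma matrix_mult_join_column: "A ** join_column u S = join_column (A *v u) (A ** S)"
  by (simp add: vec_eq_iff join_column_def matrix_matrix_mult_def matrix_vector_mult_def
      split: option.split)

lemma join_column_add: "join_column u S + join_column v T = join_column (u + v) (S + T)"
  by (simp add: vec_eq_iff join_column_def split: option.split)

text \<open>Equality on \<open>S\<close> alone suffices, as is required here: the formulas for
  means, correlations and deviation are known for nonnegative times only.\<close>

lemma has_field_derivative_transform:
  assumes "x \<in> S" "\<And>y. y \<in> S \<Longrightarrow> g y = f y" "(f has_field_derivative f') (at x within S)"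
  shows "(g has_field_derivative f') (at x within S)"
  using assms unfolding has_field_derivative_def by (rule has_derivative_transform)

text \<open>The mean and the correlation matrix obey linear equations with the same drift matrix,
  which are the column blocks of z' = A z + c. \<open>R_mat\<close> collects their coefficients in
  the affine formula for the deviation.\<close>

lemma deviation_has_derivative:
  fixes ex :: "(real \<Rightarrow> complex ^ 'k::finite) \<Rightarrow> 'f::chilbert"
    and X :: "real \<Rightarrow> 'n::finite \<Rightarrow> 'f ^ 'd \<Rightarrow> 'f ^ 'd" and F :: "real ^ 'n ^ 'v"
  assumes fock: "symmetric_fock_space ex" and wiener: "quantum_wiener_process ex W"
    and D: "density_matrix D"
    and X: "\<And>s l. 0 \<le> s \<Longrightarrow> bounded_selfadjoint (X s l)"
    and init: "\<And>j. X 0 j = X0 j \<otimes>\<^sub>o id"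
    and alg: "\<And>s. 0 \<le> s \<Longrightarrow> algebraic_relations \<alpha> \<beta> (X s)"
    and qsde: "solves_qsde ex W A b \<beta> M X"
    and A: "continuous_on {0..} A"
    and t: "0 \<le> t"
  shows "(deviation ex D F X has_real_derivative
      inner (R_mat \<beta> F) (A t ** z_mat ex D X t + c_mat b (mean ex D X 0))) (at t within {0..})"
proof -
  define S where "S = transpose F ** F"
  define \<mu> where "\<mu> = mean ex D X"
  define e where "e s = P_mat ex D X + Q_mat ex D X s" for s
  define \<mu>' where "\<mu>' = A t *v \<mu> t + b"
  define e' where "e' = A t ** e t + (\<chi> j k. b $ j * \<mu> 0 $ k)"
  have D': "hermitian_matrix D" "trace D = 1"
    using D by (auto simp: density_matrix_def)
  note deriv = vev_has_derivative[OF fock wiener _ qsde A t]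
  have "((\<lambda>s. Re (vev ex D (X s j))) has_real_derivative
      (\<Sum>l\<in>UNIV. A t $ j $ l * Re (vev ex D (X t l))) + b $ j) (at t within {0..})" for j
    using deriv[of "\<lambda>\<psi>. \<psi>" "\<lambda>i. axis i 1" D j, OF X] by (simp add: vev_id[OF fock D'(2)])
  then have "((\<lambda>s. \<mu> s $ j) has_real_derivative
      (\<Sum>l\<in>UNIV. A t $ j $ l * Re (vev ex D (X t l))) + b $ j) (at t within {0..})" for j
    by (rule has_field_derivative_transform[rotated 2]) (use t in \<open>auto simp: \<mu>_def mean_eq_vev X\<close>)
  then have \<mu>': "((\<lambda>s. \<mu> s $ j) has_real_derivative \<mu>' $ j) (at t within {0..})" for j
    by (simp add: \<mu>'_def \<mu>_def mean_eq_vev[where X = X, OF X[OF t]] matrix_vector_mult_def)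
  \<comment> \<open>Initial variables act on the first factor only and preserve the vacuum in the
    second, so they qualify as \<open>Y\<close> above.\<close>
  have X0: "X 0 k (axis i 1 \<otimes>\<^sub>v vacuum ex) = column i (X0 k) \<otimes>\<^sub>v vacuum ex" for i k
  proof -
    have "(X0 k $ p $ q) *\<^sub>C (axis i 1 :: complex ^ 'd) $ q *\<^sub>C vacuum ex
        = (if q = i then (X0 k $ p $ i) *\<^sub>C vacuum ex else 0)" for p q
      by (simp add: axis_def)
    then show ?thesis
      by (simp add: init tensor_op_def tensor_vec_def column_def vec_eq_iff)
  qed
  have "((\<lambda>s. Re (vev ex D (\<lambda>\<psi>. X s j (X 0 k \<psi>)))) has_real_derivative
      (\<Sum>l\<in>UNIV. A t $ j $ l * e t $ l $ k) + b $ j * \<mu> 0 $ k) (at t within {0..})" for j k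
    using deriv[of "X 0 k" "\<lambda>i. column i (X0 k)" D j, OF X X0]
    by (simp add: e_def P_plus_Q_eq_vev[OF X t] \<mu>_def mean_eq_vev X
        del: vector_add_component)
  then have "((\<lambda>s. e s $ j $ k) has_real_derivative
      (\<Sum>l\<in>UNIV. A t $ j $ l * e t $ l $ k) + b $ j * \<mu> 0 $ k) (at t within {0..})" for j k
    by (rule has_field_derivative_transform[rotated 2])
      (use t in \<open>auto simp: e_def P_plus_Q_eq_vev[OF X] simp del: vector_add_component\<close>)
  then have e': "((\<lambda>s. e s $ j $ k) has_real_derivative e' $ j $ k) (at t within {0..})" for j k
    by (simp add: e'_def matrix_matrix_mult_def)
  \<comment> \<open>The leading 0 is the derivative of the time-independent term of the
    deviation.\<close>
  have "((\<lambda>s. inner S (P_mat ex D X + \<alpha>) + (inner (S \<star> Re_array \<beta>) (\<mu> s) - 2 * inner S (e s)))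
      has_real_derivative 0 + (inner (S \<star> Re_array \<beta>) \<mu>' - 2 * inner S e')) (at t within {0..})"
    unfolding inner_vec_def inner_real_def
    by (intro DERIV_add DERIV_const DERIV_diff DERIV_cmult DERIV_sum \<mu>' e')
  then have "(deviation ex D F X has_real_derivative
      0 + (inner (S \<star> Re_array \<beta>) \<mu>' - 2 * inner S e')) (at t within {0..})"
    by (rule has_field_derivative_transform[rotated 2])
      (use t in \<open>auto simp: deviation_eq[OF fock D' X alg] S_def \<mu>_def e_def\<close>)
  moreover have "inner (R_mat \<beta> F) (A t ** z_mat ex D X t + c_mat b (mean ex D X 0))
      = inner (S \<star> Re_array \<beta>) \<mu>' - 2 * inner S e'"
    by (simp add: R_mat_def z_mat_def c_mat_def matrix_mult_join_column join_column_add
        inner_join_column Let_def S_def[symmetric] \<mu>_def[symmetric] e_def[symmetric]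
        \<mu>'_def e'_def)
  ultimately show ?thesis
    by simp
qed

section \<open>Dependence on the control value and quadratic minimisation\<close>

text \<open>For the Frobenius product, right multiplication by \<open>transpose v\<close> is adjoint
  to right multiplication by \<open>v\<close>; this isolates each section of the array and exhibits
  \<open>g_fun\<close> as the gradient in \<open>u\<close>.\<close>

lemma deviation_rate_affine: "deviation_rate R c As \<A> v u = f_fun R c As v + inner (g_fun R \<A> v) u"
proof -
  have "inner R ((\<A> $ k) ** v) = inner (R ** transpose v) (\<A> $ k)" for k
  proof -
    have "inner R ((\<A> $ k) ** v) = (\<Sum>i\<in>UNIV. \<Sum>p\<in>UNIV. \<Sum>q\<in>UNIV. R $ i $ p * (\<A> $ k $ i $ q * v $ q $ p))"
      by (simp add: inner_vec_def matrix_matrix_mult_def sum_distrib_left)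
    also have "\<dots> = (\<Sum>i\<in>UNIV. \<Sum>q\<in>UNIV. \<Sum>p\<in>UNIV. R $ i $ p * (\<A> $ k $ i $ q * v $ q $ p))"
      by (intro sum.cong refl sum.swap)
    also have "\<dots> = inner (R ** transpose v) (\<A> $ k)"
      by (simp add: inner_vec_def matrix_matrix_mult_def transpose_def sum_distrib_left mult_ac)
    finally show ?thesis .
  qed
  moreover have "(As + \<A> \<cdot>\<^sub>a u) ** v = As ** v + (\<A> \<cdot>\<^sub>a u) ** v"
    by (simp add: vec_eq_iff matrix_matrix_mult_def distrib_right sum.distrib)
  moreover have "(\<A> \<cdot>\<^sub>a u) ** v = (\<Sum>k\<in>UNIV. u $ k *\<^sub>R ((\<A> $ k) ** v))"
    by (simp add: vec_eq_iff array_dot_def matrix_matrix_mult_def sum_distrib_left sum_distrib_right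
        mult.assoc) (intro allI sum.swap)
  ultimately show ?thesis
    by (simp add: deviation_rate_def f_fun_def inner_add_right inner_sum_right g_fun_def star_def
        inner_vec_def[of _ u] mult.commute)
qed

text \<open>A positive definite matrix has trivial kernel and is therefore invertible.\<close>

lemma pos_def_matrix_inv:
  assumes "pos_def S"
  shows "S *v (matrix_inv S *v x) = x"
proof -
  have "S *v u \<noteq> 0" if "u \<noteq> 0" for u
    using assms that unfolding pos_def_def by force
  then have "invertible S"
    by (metis invertible_left_inverse matrix_left_invertible_ker)
  then have "S ** matrix_inv S = mat 1"
    unfolding invertible_def matrix_inv_def by (rule someI2_ex) simp
  then show ?thesis
    by (simp add: matrix_vector_mul_assoc)
qed

text \<open>Complete the square around the stationary point \<open>m\<close>, where
  \<open>S *v m = - g\<close>. The remainder is positive away from \<open>m\<close>, which yields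
  existence and uniqueness together.\<close>

lemma quadratic_arg_min:
  fixes S :: "real ^ 'r ^ 'r"
  assumes S: "pos_def S"
  shows "is_arg_min (\<lambda>w. a + inner g w + 1 / 2 * weighted_norm_sq S w) (\<lambda>w. True) u
    \<longleftrightarrow> u = - (matrix_inv S *v g)"
proof -
  define m where "m = - (matrix_inv S *v g)"
  let ?q = "\<lambda>w. a + inner g w + 1 / 2 * weighted_norm_sq S w"
  have Sm: "S *v m = - g"
    using pos_def_matrix_inv[OF S] by (simp add: m_def linear_neg[OF matrix_vector_mul_linear])
  have sym: "inner (S *v x) y = inner x (S *v y)" for x y
    using S by (metis dot_lmul_matrix pos_def_def vector_transpose_matrix)
  have square: "?q w = ?q m + 1 / 2 * inner (w - m) (S *v (w - m))" for w
  proof -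
    have "inner m (S *v w) = - inner g w"
      using sym[of m w] Sm by simp
    moreover have "inner w g = inner g w" "inner m g = inner g m"
      by (simp_all add: inner_commute)
    ultimately show ?thesis
      using Sm by (simp add: weighted_norm_sq_def matrix_vector_mult_diff_distrib inner_diff_left
          inner_diff_right field_simps inner_add_right)
  qed
  have pos: "0 < inner (w - m) (S *v (w - m))" if "w \<noteq> m" for w
    using S that by (simp add: pos_def_def)
  show ?thesis
    unfolding is_arg_min_linorder m_def[symmetric]
  proof safe
    assume "\<forall>y. True \<longrightarrow> ?q u \<le> ?q y"
    then have "?q u \<le> ?q m"
      by blast
    then show "u = m"
      using square[of u] pos[of u] by fastforce
  next
    fix y
    show "?q m \<le> ?q y"
      using square[of y] pos[of y] by (cases "y = m") auto
  qed
qed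

text \<open>\<open>Wt\<close> is the weight \<Pi>. The rate is minimised as a function of a free
  control value with \<open>z t\<close> fixed; the first conjunct ties this function to the actual
  derivative of the deviation, one-sided at time 0.\<close>

theorem theorem2:
  fixes ex :: "(real \<Rightarrow> complex ^ ('k::finite)) \<Rightarrow> 'f::chilbert"
    and W :: "real \<Rightarrow> 'k \<times> bool \<Rightarrow> 'f \<Rightarrow> 'f"
    and \<rho>0 :: "complex ^ 'd ^ 'd"
    and X0 :: "'n::finite \<Rightarrow> complex ^ 'd ^ 'd"
    and X :: "real \<Rightarrow> 'n \<Rightarrow> 'f ^ 'd \<Rightarrow> 'f ^ 'd"
    and \<alpha> :: "real ^ 'n ^ 'n"
    and \<beta> :: "complex ^ 'n ^ 'n ^ 'n"
    and E :: "real ^ 'n" and K :: "real ^ 'r ^ 'n"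
    and M :: "real ^ 'n ^ ('k \<times> bool)" and N :: "real ^ ('k \<times> bool)"
    and U :: "real \<Rightarrow> real ^ 'r"
    and F :: "real ^ 'n ^ 'v"
    and Wt :: "real ^ 'r ^ 'r"
    and b :: "real ^ 'n" and As :: "real ^ 'n ^ 'n" and \<A> :: "real ^ 'n ^ 'n ^ 'r"
    and R c :: "real ^ 'n option ^ 'n"
    and z :: "real \<Rightarrow> real ^ 'n option ^ 'n"
    and \<Delta> :: "real \<Rightarrow> real"
    and f :: "real ^ 'n option ^ 'n \<Rightarrow> real"
    and g :: "real ^ 'n option ^ 'n \<Rightarrow> real ^ 'r"
    and dotDelta :: "real ^ 'n option ^ 'n \<Rightarrow> real ^ 'r \<Rightarrow> real"
    and Uhat :: "real ^ 'r"
    and t :: real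
  assumes fock: "symmetric_fock_space ex"
    and wiener: "quantum_wiener_process ex W"
    and state: "density_matrix \<rho>0"
    and alpha: "transpose \<alpha> = \<alpha>"
    and beta: "\<And>l. hermitian_matrix (\<beta> $ l)"
    and control: "continuous_on {0..} U"
    and F_rank: "rank F = CARD('v)"
    and Wt: "pos_def Wt"
    and b_eq: "b = drift_vec \<alpha> \<beta> M"
    and As_eq: "As = A_star \<beta> E M N"
    and A_eq: "\<A> = A_array \<beta> K"
    and X0_hermitian: "\<And>j. hermitian_matrix (X0 j)"
    and X_init: "\<And>j. X 0 j = X0 j \<otimes>\<^sub>o id"
    and X_selfadjoint: "\<And>s j. 0 \<le> s \<Longrightarrow> bounded_selfadjoint (X s j)"
    and X_algebra: "\<And>s. 0 \<le> s \<Longrightarrow> algebraic_relations \<alpha> \<beta> (X s)"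
    and X_qsde: "solves_qsde ex W (\<lambda>s. As + \<A> \<cdot>\<^sub>a U s) b \<beta> M X"
    and R_eq: "R = R_mat \<beta> F"
    and c_eq: "c = c_mat b (mean ex \<rho>0 X 0)"
    and z_eq: "z = z_mat ex \<rho>0 X"
    and Delta_eq: "\<Delta> = deviation ex \<rho>0 F X"
    and f_eq: "f = f_fun R c As"
    and g_eq: "g = g_fun R \<A>"
    and dotDelta_eq: "dotDelta = deviation_rate R c As \<A>"
    and t: "0 \<le> t"
    and Uhat_eq: "Uhat = - (matrix_inv Wt *v g (z t))"
  shows
    "(\<Delta> has_real_derivative dotDelta (z t) (U t)) (at t within {0..}) \<and>
     (\<forall>u. is_arg_min (\<lambda>w. dotDelta (z t) w + 1 / 2 * weighted_norm_sq Wt w) (\<lambda>w. True) u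
        \<longleftrightarrow> u = Uhat) \<and>
     dotDelta (z t) Uhat = f (z t) - weighted_norm_sq (matrix_inv Wt) (g (z t)) \<and>
     (U t = Uhat \<longrightarrow>
        (\<Delta> has_real_derivative f (z t) - weighted_norm_sq (matrix_inv Wt) (g (z t)))
          (at t within {0..}))"
  proof -
  let ?g = "g (z t)"
  have cont: "continuous_on {0..} (\<lambda>s. As + \<A> \<cdot>\<^sub>a U s)"
    unfolding array_dot_def by (intro continuous_intros control)
  have deriv: "(\<Delta> has_real_derivative dotDelta (z t) (U t)) (at t within {0..})"
    using deviation_has_derivative[OF fock wiener state X_selfadjoint X_init X_algebra X_qsde cont t]
    by (simp add: Delta_eq dotDelta_eq deviation_rate_def R_eq c_eq z_eq)
  have affine: "dotDelta (z t) w = f (z t) + inner ?g w" for w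
    by (simp add: dotDelta_eq f_eq g_eq deviation_rate_affine)
  have "is_arg_min (\<lambda>w. dotDelta (z t) w + 1 / 2 * weighted_norm_sq Wt w) (\<lambda>w. True) u
      \<longleftrightarrow> u = Uhat" for u
    unfolding affine Uhat_eq by (rule quadratic_arg_min[OF Wt])
  \<comment> \<open>The penalty is not part of the rate, so the quadratic term appears with
    coefficient 1 rather than 1/2.\<close>
  moreover have "dotDelta (z t) Uhat = f (z t) - weighted_norm_sq (matrix_inv Wt) ?g"
    by (simp add: affine Uhat_eq weighted_norm_sq_def)
  ultimately show ?thesis
    using deriv by auto
qed

end
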